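(* (a) There is a constant $c>0$ such that for every $k\in\mathbb{N}$, every unsatisfiable $k$-CNF formula $F$ satisfies $e(F)\geq c\cdot 2.69^k$. (b) There is a constant $C>0$ such that for every $k\in\mathbb{N}$ there exists an unsatisfiable $k$-CNF formula $F$ with $e(F)\leq C\cdot 3.51^k$.
   Context: A literal is a boolean variable $x$ or its negation $\bar{x}$. A clause is a finite set of literals (a disjunction) containing no variable together with its negation; a CNF formula is a finite set of clauses (their conjunction). A $k$-CNF formula is a CNF formula in which every clause contains exactly $k$ literals. Two clauses conflict if there is a variable appearing positively in one of them and negatively in the other. $e(F)$ denotes the number of unordered pairs of clauses of $F$ that conflict (the number of edges of the conflict graph of $F$). *)

theory Defs
  imports Complex_Main
begin

datatype 'v literal = Pos 'v | Neg 'v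

type_synonym 'v clause = "'v literal set"

type_synonym 'v cnf = "'v clause set"

definition is_clause :: "'v clause \<Rightarrow> bool" where
  "is_clause C \<longleftrightarrow> finite C \<and> \<not> (\<exists>x. Pos x \<in> C \<and> Neg x \<in> C)"

definition is_cnf :: "'v cnf \<Rightarrow> bool" where
  "is_cnf F \<longleftrightarrow> finite F \<and> (\<forall>C\<in>F. is_clause C)"

definition is_k_cnf :: "nat \<Rightarrow> 'v cnf \<Rightarrow> bool" where
  "is_k_cnf k F \<longleftrightarrow> is_cnf F \<and> (\<forall>C\<in>F. card C = k)"

fun lit_true :: "('v \<Rightarrow> bool) \<Rightarrow> 'v literal \<Rightarrow> bool" where
  "lit_true \<alpha> (Pos x) \<longleftrightarrow> \<alpha> x"
| "lit_true \<alpha> (Neg x) \<longleftrightarrow> \<not> \<alpha> x"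

definition satisfies :: "('v \<Rightarrow> bool) \<Rightarrow> 'v cnf \<Rightarrow> bool" where
  "satisfies \<alpha> F \<longleftrightarrow> (\<forall>C\<in>F. \<exists>l\<in>C. lit_true \<alpha> l)"

definition satisfiable :: "'v cnf \<Rightarrow> bool" where
  "satisfiable F \<longleftrightarrow> (\<exists>\<alpha>. satisfies \<alpha> F)"

definition conflict :: "'v clause \<Rightarrow> 'v clause \<Rightarrow> bool" where
  "conflict C D \<longleftrightarrow> (\<exists>x. (Pos x \<in> C \<and> Neg x \<in> D) \<or> (Neg x \<in> C \<and> Pos x \<in> D))"

definition conflict_edges :: "'v cnf \<Rightarrow> 'v clause set set" where
  "conflict_edges F = {{C, D} | C D. C \<in> F \<and> D \<in> F \<and> C \<noteq> D \<and> conflict C D}"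

definition num_conflicts :: "'v cnf \<Rightarrow> nat" where
  "num_conflicts F = card (conflict_edges F)"

end

theory Submission
  imports Defs "HOL-Probability.Product_PMF"
begin

text \<open>Lower bound: suppose \<open>F\<close> has fewer than \<open>eta ^ k / (128 k\<^sup>3)\<close> conflicts. Set each variable
  independently, favouring its more frequent literal, the more so the more often it occurs. Clauses
  containing a literal that fails with probability above \<open>1/2\<close> are so few, relative to their
  failure probability, that their total failure probability is at most \<open>1 / (8 k)\<close>. Every other
  clause \<open>C\<close> can be truncated to a nonempty \<open>C'\<close> whose failure probability is at most
  \<open>1 / (8 k d(l))\<close> for all \<open>l \<in> C'\<close>, where \<open>d(l)\<close> counts the occurrences of \<open>l\<close>: otherwise
  a potential function would grow by \<open>1 / k\<close> with each of the \<open>k\<close> literals, although it stays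
  below \<open>1\<close>. The lopsided local lemma then satisfies the truncated formula, hence \<open>F\<close>.

  Upper bound: take few positive \<open>k\<close>-clauses that refute all assignments with at most
  \<open>0.37 n\<close> true variables, and few negative \<open>k/3\<close>-clauses that refute all others. Extend each
  of the latter to \<open>k\<close>-clauses by all sign patterns on its own set of fresh variables.\<close>

section \<open>Polynomial and exponential growth\<close>

lemma polynomial_times_power_bounded:
  fixes y :: real
  assumes "0 \<le> y" "y < 1"
  shows "\<exists>B>0. \<forall>n. real n ^ m * y ^ n \<le> B"
  using assms
proof (induction m arbitrary: y)
  case 0
  then show ?case
    by (intro exI[of _ 1]) (simp add: power_le_one)
next
  case (Suc m)
  have y: "0 \<le> sqrt y" "sqrt y < 1"
    using Suc.prems by (simp_all add: real_less_lsqrt)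
  obtain B where B: "0 < B" "\<And>n. real n ^ m * sqrt y ^ n \<le> B"
    using Suc.IH[OF y] by blast
  have "(\<lambda>n. real n * sqrt y ^ n) \<longlonglongrightarrow> 0"
    using powser_times_n_limit_0[of "sqrt y"] y by simp
  then have "Bseq (\<lambda>n. real n * sqrt y ^ n)"
    by (intro convergent_imp_Bseq convergentI)
  then obtain C where C: "0 < C" "\<And>n. norm (real n * sqrt y ^ n) \<le> C"
    unfolding Bseq_def by blast
  have "real n ^ Suc m * y ^ n \<le> B * C" for n
  proof -
    have "real n ^ Suc m * y ^ n = (real n ^ m * sqrt y ^ n) * (real n * sqrt y ^ n)"
      using Suc.prems(1) by (simp add: power_mult_distrib[symmetric])
    also have "\<dots> \<le> B * C"
      using B C y(1) by (intro mult_mono) auto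
    finally show ?thesis .
  qed
  then show ?case
    using B(1) C(1) by (intro exI[of _ "B * C"]) auto
qed

lemma polynomial_times_power_le:
  fixes a b :: real
  assumes "0 \<le> a" "a < b"
  shows "\<exists>B>0. \<forall>n. real n ^ m * a ^ n \<le> B * b ^ n"
proof -
  obtain B where B: "0 < B" "\<And>n. real n ^ m * (a / b) ^ n \<le> B"
    using polynomial_times_power_bounded[of "a / b" m] assms by auto
  have "real n ^ m * a ^ n \<le> B * b ^ n" for n
    using B(2)[of n] assms by (simp add: power_divide divide_le_eq)
  then show ?thesis
    using B(1) by blast
qed

section \<open>The lopsided local lemma\<close>

lemma prod_antimono_set:
  fixes f :: "'a \<Rightarrow> 'b::linordered_idom"
  assumes "finite B" "A \<subseteq> B" "\<And>b. b \<in> B \<Longrightarrow> 0 \<le> f b" "\<And>b. b \<in> B - A \<Longrightarrow> f b \<le> 1"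
  shows "prod f B \<le> prod f A"
proof -
  have "prod f B = prod f (B - A) * prod f A"
    using assms(1,2) by (rule prod.subset_diff[rotated])
  also have "\<dots> \<le> 1 * prod f A"
    using assms by (intro mult_right_mono prod_le_1 prod_nonneg) auto
  finally show ?thesis by simp
qed

definition avoiding :: "'a measure \<Rightarrow> ('i \<Rightarrow> 'a set) \<Rightarrow> 'i set \<Rightarrow> 'a set" where
  "avoiding M A J = space M - (\<Union>j\<in>J. A j)"

lemma avoiding_empty [simp]: "avoiding M A {} = space M"
  by (simp add: avoiding_def)

lemma avoiding_insert: "avoiding M A (insert j J) = avoiding M A J - A j \<inter> avoiding M A J"
  by (auto simp: avoiding_def)

lemma avoiding_antimono: "J \<subseteq> K \<Longrightarrow> avoiding M A K \<subseteq> avoiding M A J"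
  by (auto simp: avoiding_def)

lemma avoiding_in_sets:
  "finite J \<Longrightarrow> A ` J \<subseteq> sets M \<Longrightarrow> avoiding M A J \<in> sets M"
  by (auto simp: avoiding_def)

context prob_space
begin

lemma prob_avoiding_Un_ge:
  assumes "finite S" "finite T" and events: "A ` (S \<union> T) \<subseteq> events"
    and x_le_1: "\<And>j. j \<in> T \<Longrightarrow> x j \<le> 1"
    and step: "\<And>j U. j \<in> T \<Longrightarrow> U \<subseteq> T - {j} \<Longrightarrow>
      prob (A j \<inter> avoiding M A (S \<union> U)) \<le> x j * prob (avoiding M A (S \<union> U))"
  shows "(\<Prod>j\<in>T. 1 - x j) * prob (avoiding M A S) \<le> prob (avoiding M A (S \<union> T))"
  using assms(2) events x_le_1 step
proof (induction T rule: finite_induct)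
  case empty
  then show ?case by simp
next
  case (insert j T)
  let ?E = "avoiding M A (S \<union> T)"
  have "?E \<in> events" and "A j \<in> events"
    using insert.hyps insert.prems(1) \<open>finite S\<close> by (auto intro!: avoiding_in_sets)
  have "(\<Prod>i\<in>T. 1 - x i) * prob (avoiding M A S) \<le> prob ?E"
  proof (rule insert.IH)
    show "prob (A i \<inter> avoiding M A (S \<union> U)) \<le> x i * prob (avoiding M A (S \<union> U))"
      if "i \<in> T" "U \<subseteq> T - {i}" for i U
      using insert.prems(3)[of i U] that by blast
  qed (use insert.prems in auto)
  then have "(1 - x j) * ((\<Prod>i\<in>T. 1 - x i) * prob (avoiding M A S)) \<le> (1 - x j) * prob ?E"
    using insert.prems(2) by (intro mult_left_mono) auto
  also have "\<dots> \<le> prob ?E - prob (A j \<inter> ?E)"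
    using insert.prems(3)[of j T] insert.hyps(2) by (simp add: algebra_simps)
  also have "\<dots> = prob (?E - A j \<inter> ?E)"
    using \<open>?E \<in> events\<close> \<open>A j \<in> events\<close> by (intro finite_measure_Diff[symmetric]) auto
  finally show ?case
    using insert.hyps by (simp add: avoiding_insert mult.assoc)
qed

context
  fixes A :: "'i \<Rightarrow> 'a set" and I :: "'i set" and x :: "'i \<Rightarrow> real" and N :: "'i \<Rightarrow> 'i set"
  assumes finite_I: "finite I" and events: "A ` I \<subseteq> events"
    and x_nonneg: "\<And>i. i \<in> I \<Longrightarrow> 0 \<le> x i" and x_le_1: "\<And>i. i \<in> I \<Longrightarrow> x i \<le> 1"
    and N_subset: "\<And>i. i \<in> I \<Longrightarrow> N i \<subseteq> I"
    and lopsided: "\<And>i J. i \<in> I \<Longrightarrow> J \<subseteq> I - insert i (N i) \<Longrightarrow>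
      prob (A i \<inter> avoiding M A J) \<le> x i * (\<Prod>j\<in>N i. 1 - x j) * prob (avoiding M A J)"
begin

lemma prob_Int_avoiding_le:
  assumes "S \<subseteq> I" "i \<in> I - S"
  shows "prob (A i \<inter> avoiding M A S) \<le> x i * prob (avoiding M A S)"
proof -
  have "finite S"
    using assms(1) finite_I finite_subset by blast
  then show ?thesis
    using assms
  proof (induction S arbitrary: i rule: finite_psubset_induct)
    case (psubset S)
    define near far where "near = N i \<inter> S" and "far = S - N i"
    have S: "S = far \<union> near" and [simp]: "finite near" "finite far"
      using \<open>finite S\<close> by (auto simp: near_def far_def)
    have "avoiding M A far \<in> events"
      using \<open>finite far\<close> events psubset.prems by (intro avoiding_in_sets) (auto simp: S)
    have "prob (A i \<inter> avoiding M A S) \<le> prob (A i \<inter> avoiding M A far)"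
      using \<open>avoiding M A far \<in> events\<close> events psubset.prems avoiding_antimono[of far S M A]
      by (intro finite_measure_mono) (auto simp: S)
    also have "\<dots> \<le> x i * ((\<Prod>j\<in>N i. 1 - x j) * prob (avoiding M A far))"
      using lopsided[of i far] psubset.prems by (auto simp: far_def mult.assoc)
    also have "\<dots> \<le> x i * ((\<Prod>j\<in>near. 1 - x j) * prob (avoiding M A far))"
    proof -
      have "(\<Prod>j\<in>N i. 1 - x j) \<le> (\<Prod>j\<in>near. 1 - x j)"
        using N_subset[of i] psubset.prems finite_I x_nonneg x_le_1
        by (intro prod_antimono_set) (auto simp: near_def intro: finite_subset)
      then show ?thesis
        using psubset.prems x_nonneg by (intro mult_left_mono mult_right_mono) auto
    qed
    also have "\<dots> \<le> x i * prob (avoiding M A (far \<union> near))"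
    proof (intro mult_left_mono prob_avoiding_Un_ge)
      show "prob (A j \<inter> avoiding M A (far \<union> U)) \<le> x j * prob (avoiding M A (far \<union> U))"
        if "j \<in> near" "U \<subseteq> near - {j}" for j U
        using that psubset.prems by (intro psubset.IH) (auto simp: near_def far_def)
    qed (use \<open>finite near\<close> \<open>finite far\<close> events psubset.prems x_nonneg x_le_1 in \<open>auto simp: S\<close>)
    finally show ?case
      using S by simp
  qed
qed

theorem lopsided_local_lemma: "(\<Prod>i\<in>I. 1 - x i) \<le> prob (avoiding M A I)"
  using prob_avoiding_Un_ge[of "{}" I A x] finite_I events x_le_1 prob_Int_avoiding_le
  by (simp add: prob_space subset_Diff_insert)

end

end

section \<open>Random assignments\<close>

lemma Pi_pmf_resample:
  assumes "finite V" "x \<in> V"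
  shows "map_pmf (\<lambda>(y, f). f(x := y)) (pair_pmf (p x) (Pi_pmf V d p)) = Pi_pmf V d p"
proof -
  have "Pi_pmf V d p = map_pmf (\<lambda>(y, f). f(x := y)) (pair_pmf (p x) (Pi_pmf (V - {x}) d p))"
    using Pi_pmf_insert[of "V - {x}" x d p] assms by (simp add: insert_absorb)
  also have "\<dots> = map_pmf (\<lambda>(y, f). f(x := y)) (pair_pmf (p x) (Pi_pmf V d p))"
    using assms(1) by (simp add: Pi_pmf_remove pair_map_pmf2 map_pmf_comp case_prod_unfold)
  finally show ?thesis ..
qed

lemma prob_Pi_pmf_coordinate_le:
  assumes "finite V" "x \<in> V" and closed: "\<And>f z. f \<in> E \<Longrightarrow> f x = y \<Longrightarrow> f(x := z) \<in> E"
  shows "measure_pmf.prob (Pi_pmf V d p) ({f. f x = y} \<inter> E)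
    \<le> pmf (p x) y * measure_pmf.prob (Pi_pmf V d p) E"
proof -
  let ?M = "Pi_pmf V d p"
  define E' where "E' = {f. f(x := y) \<in> E} \<inter> set_pmf ?M"
  have "E' \<subseteq> E"
  proof
    fix f assume "f \<in> E'"
    then show "f \<in> E"
      using closed[of "f(x := y)" "f x"] by (simp add: E'_def)
  qed
  have "measure_pmf.prob ?M ({f. f x = y} \<inter> E)
      = measure_pmf.prob (pair_pmf (p x) ?M) ((\<lambda>(z, f). f(x := z)) -` ({f. f x = y} \<inter> E))"
    using Pi_pmf_resample[OF assms(1,2), of p d] measure_map_pmf by metis
  also have "\<dots> = measure_pmf.prob (pair_pmf (p x) ?M) ({y} \<times> E')"
    by (rule measure_prob_cong_0) (auto simp: E'_def set_pmf_iff pmf_pair)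
  also have "\<dots> = pmf (p x) y * measure_pmf.prob ?M E'"
    by (subst measure_pmf_prob_product) (auto simp: E'_def measure_pmf_single)
  also have "\<dots> \<le> pmf (p x) y * measure_pmf.prob ?M E"
    using \<open>E' \<subseteq> E\<close> by (intro mult_left_mono measure_pmf.finite_measure_mono) auto
  finally show ?thesis .
qed

fun lit_var :: "'v literal \<Rightarrow> 'v" where
  "lit_var (Pos x) = x"
| "lit_var (Neg x) = x"

fun compl_lit :: "'v literal \<Rightarrow> 'v literal" where
  "compl_lit (Pos x) = Neg x"
| "compl_lit (Neg x) = Pos x"

fun falsifying_value :: "'v literal \<Rightarrow> bool" where
  "falsifying_value (Pos x) = False"
| "falsifying_value (Neg x) = True"

definition falsifies :: "('v \<Rightarrow> bool) \<Rightarrow> 'v clause \<Rightarrow> bool" where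
  "falsifies \<alpha> C \<longleftrightarrow> (\<forall>l\<in>C. \<not> lit_true \<alpha> l)"

definition lit_fail :: "('v \<Rightarrow> bool pmf) \<Rightarrow> 'v literal \<Rightarrow> real" where
  "lit_fail p l = pmf (p (lit_var l)) (falsifying_value l)"

definition clause_fail :: "('v \<Rightarrow> bool pmf) \<Rightarrow> 'v clause \<Rightarrow> real" where
  "clause_fail p C = (\<Prod>l\<in>C. lit_fail p l)"

lemma satisfies_iff: "satisfies \<alpha> F \<longleftrightarrow> (\<forall>C\<in>F. \<not> falsifies \<alpha> C)"
  by (simp add: satisfies_def falsifies_def)

lemma not_lit_true_iff: "\<not> lit_true \<alpha> l \<longleftrightarrow> \<alpha> (lit_var l) = falsifying_value l"
  by (cases l) auto

lemma lit_true_update_iff: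
  "lit_true (\<alpha>(lit_var l := \<not> falsifying_value l)) m
    \<longleftrightarrow> m = l \<or> (lit_true \<alpha> m \<and> m \<noteq> compl_lit l)"
  by (cases l; cases m) auto

lemma conflict_iff: "conflict C D \<longleftrightarrow> (\<exists>l\<in>C. compl_lit l \<in> D)"
  unfolding conflict_def by (metis compl_lit.elims compl_lit.simps)

lemma is_clause_iff: "is_clause C \<longleftrightarrow> finite C \<and> (\<forall>l\<in>C. compl_lit l \<notin> C)"
  unfolding is_clause_def by (metis compl_lit.elims compl_lit.simps)

lemma lit_fail_nonneg: "0 \<le> lit_fail p l"
  by (simp add: lit_fail_def)

lemma clause_fail_nonneg: "0 \<le> clause_fail p C"
  by (simp add: clause_fail_def prod_nonneg lit_fail_nonneg)

lemma prob_falsifies_Int_le: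
  assumes "finite V" and C: "is_clause C" "lit_var ` C \<subseteq> V"
    and closed: "\<And>\<alpha> l. \<alpha> \<in> E \<Longrightarrow> l \<in> C \<Longrightarrow> \<alpha>(lit_var l := \<not> falsifying_value l) \<in> E"
  shows "measure_pmf.prob (Pi_pmf V d p) ({\<alpha>. falsifies \<alpha> C} \<inter> E)
    \<le> clause_fail p C * measure_pmf.prob (Pi_pmf V d p) E"
proof -
  let ?P = "measure_pmf.prob (Pi_pmf V d p)"
  have "finite C"
    using C(1) by (simp add: is_clause_def)
  then show ?thesis
    using C closed
  proof (induction C rule: finite_induct)
    case empty
    then show ?case by (simp add: falsifies_def clause_fail_def)
  next
    case (insert l C)
    let ?E = "{\<alpha>. falsifies \<alpha> C} \<inter> E"
    have "{\<alpha>. falsifies \<alpha> (insert l C)} \<inter> E = {\<alpha>. \<alpha> (lit_var l) = falsifying_value l} \<inter> ?E"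
      by (auto simp: falsifies_def not_lit_true_iff)
    also have "?P \<dots> \<le> lit_fail p l * ?P ?E"
      unfolding lit_fail_def
    proof (rule prob_Pi_pmf_coordinate_le)
      fix \<alpha> b assume \<alpha>: "\<alpha> \<in> ?E" "\<alpha> (lit_var l) = falsifying_value l"
      have "\<alpha>(lit_var l := \<not> falsifying_value l) \<in> E"
        using \<alpha>(1) insert.prems(3)[of \<alpha> l] by blast
      moreover have "falsifies (\<alpha>(lit_var l := \<not> falsifying_value l)) C"
        using \<alpha>(1) insert.hyps(2) by (auto simp: falsifies_def lit_true_update_iff)
      moreover have "\<alpha>(lit_var l := falsifying_value l) = \<alpha>"
        using \<alpha>(2) by (simp flip: \<alpha>(2))
      ultimately show "\<alpha>(lit_var l := b) \<in> ?E"
        using \<alpha>(1) by (cases "b = falsifying_value l") auto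
    qed (use \<open>finite V\<close> insert.prems in auto)
    also have "\<dots> \<le> lit_fail p l * (clause_fail p C * ?P E)"
    proof (intro mult_left_mono lit_fail_nonneg insert.IH)
      show "is_clause C"
        using insert.prems(1) by (auto simp: is_clause_iff)
    qed (use insert.prems in auto)
    finally show ?case
      using insert.hyps by (simp add: clause_fail_def mult.assoc)
  qed
qed

text \<open>Making a literal of \<open>C i\<close> true can only break clauses that conflict with \<open>C i\<close>.\<close>

lemma prob_falsifies_Int_avoiding_le:
  fixes C :: "'i \<Rightarrow> 'v clause" and V :: "'v set" and d :: bool and p :: "'v \<Rightarrow> bool pmf"
  defines "M \<equiv> measure_pmf (Pi_pmf V d p)" and "A \<equiv> \<lambda>i. {\<alpha>. falsifies \<alpha> (C i)}"
  assumes "finite V" "is_clause (C i)" "lit_var ` C i \<subseteq> V"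
    and no_conflict: "\<And>j. j \<in> J \<Longrightarrow> \<not> conflict (C i) (C j)"
  shows "measure M (A i \<inter> avoiding M A J) \<le> clause_fail p (C i) * measure M (avoiding M A J)"
  unfolding A_def M_def
proof (rule prob_falsifies_Int_le[OF assms(3-5)])
  fix \<alpha> l
  assume \<alpha>: "\<alpha> \<in> avoiding (measure_pmf (Pi_pmf V d p)) (\<lambda>i. {\<alpha>. falsifies \<alpha> (C i)}) J"
    and "l \<in> C i"
  have "compl_lit l \<notin> C j" if "j \<in> J" for j
    using no_conflict[OF that] \<open>l \<in> C i\<close> by (auto simp: conflict_iff)
  then show "\<alpha>(lit_var l := \<not> falsifying_value l)
      \<in> avoiding (measure_pmf (Pi_pmf V d p)) (\<lambda>i. {\<alpha>. falsifies \<alpha> (C i)}) J"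
    using \<alpha> by (fastforce simp: avoiding_def falsifies_def lit_true_update_iff)
qed

theorem clauses_satisfiable_if_conflict_sums_le:
  fixes C :: "'i \<Rightarrow> 'v clause"
  assumes "finite I" and clauses: "\<And>i. i \<in> I \<Longrightarrow> is_clause (C i)"
    and small: "\<And>i. i \<in> I \<Longrightarrow> clause_fail p (C i) < 1 / 2"
    and neighbours: "\<And>i. i \<in> I \<Longrightarrow>
      (\<Sum>j | j \<in> I \<and> conflict (C i) (C j). clause_fail p (C j)) \<le> 1 / 4"
  shows "\<exists>\<alpha>. \<forall>i\<in>I. \<not> falsifies \<alpha> (C i)"
proof -
  define V where "V = (\<Union>i\<in>I. lit_var ` C i)"
  define M where "M = measure_pmf (Pi_pmf V False p)"
  interpret prob_space M
    unfolding M_def by (rule measure_pmf.prob_space_axioms)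
  define A where "A = (\<lambda>i. {\<alpha>. falsifies \<alpha> (C i)})"
  define x where "x i = 2 * clause_fail p (C i)" for i
  define N where "N i = {j\<in>I. conflict (C i) (C j)}" for i
  have V: "finite V" "\<And>i. i \<in> I \<Longrightarrow> lit_var ` C i \<subseteq> V"
    using assms(1) clauses by (auto simp: V_def is_clause_def)
  have x: "0 \<le> x i" "x i < 1" if "i \<in> I" for i
    using that small[of i] by (auto simp: x_def clause_fail_nonneg)
  have "(\<Prod>i\<in>I. 1 - x i) \<le> prob (avoiding M A I)"
  proof (rule lopsided_local_lemma[where N = N])
    fix i J assume i: "i \<in> I" and J: "J \<subseteq> I - insert i (N i)"
    have "sum x (N i) \<le> 1 / 2"
      using neighbours[OF i] by (simp add: x_def N_def sum_distrib_left[symmetric])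
    then have "1 / 2 \<le> (\<Prod>j\<in>N i. 1 - x j)"
      using Weierstrass_prod_ineq[of "N i" x] x by (force simp: N_def)
    then have "clause_fail p (C i) \<le> x i * (\<Prod>j\<in>N i. 1 - x j)"
      using mult_left_mono[of "1 / 2" "\<Prod>j\<in>N i. 1 - x j" "x i"] x[OF i] by (simp add: x_def)
    moreover have "prob (A i \<inter> avoiding M A J) \<le> clause_fail p (C i) * prob (avoiding M A J)"
      unfolding A_def M_def using i J V clauses
      by (intro prob_falsifies_Int_avoiding_le) (auto simp: N_def)
    ultimately show "prob (A i \<inter> avoiding M A J)
        \<le> x i * (\<Prod>j\<in>N i. 1 - x j) * prob (avoiding M A J)"
      using mult_right_mono[OF _ measure_nonneg] order_trans by blast
  qed (use assms(1) x less_imp_le in \<open>auto simp: M_def N_def\<close>)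
  moreover have "0 < (\<Prod>i\<in>I. 1 - x i)"
    using x by (intro prod_pos) auto
  ultimately have "prob (avoiding M A I) \<noteq> 0"
    by linarith
  then have "avoiding M A I \<noteq> {}"
    by auto
  then show ?thesis
    by (auto simp: avoiding_def A_def)
qed

section \<open>The potential function\<close>

text \<open>The constant exceeds \<open>2.69\<close>, leaving room for polynomial factors, but not \<open>2.6916\<dots>\<close>, from
  which on the values of \<open>potential\<close> below \<open>ln eta\<close> would no longer stay below \<open>1\<close>.\<close>

definition eta :: real where
  "eta = 269001 / 100000"

definition fail_rate :: "real \<Rightarrow> real" where
  "fail_rate a = min (1 / 2) (max 0 (1 - a / eta))"

definition cost :: "real \<Rightarrow> real" where
  "cost t = - ln (fail_rate (exp t))"

definition potential :: "real \<Rightarrow> real" where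
  "potential t = integral {0..t} (\<lambda>u. 1 / cost u)"

lemma eta_pos: "0 < eta"
  by (simp add: eta_def)

lemma fail_rate_nonneg: "0 \<le> fail_rate a"
  by (simp add: fail_rate_def)

lemma fail_rate_le_half: "fail_rate a \<le> 1 / 2"
  unfolding fail_rate_def by (rule min.cobounded1)

lemma fail_rate_pos_iff: "0 < fail_rate a \<longleftrightarrow> a < eta"
  using eta_pos by (simp add: fail_rate_def less_max_iff_disj)

lemma fail_rate_antimono: "a \<le> b \<Longrightarrow> fail_rate b \<le> fail_rate a"
  unfolding fail_rate_def using eta_pos
  by (intro min.mono max.mono diff_left_mono divide_right_mono) auto

lemma fail_rate_eq: "eta / 2 \<le> a \<Longrightarrow> a < eta \<Longrightarrow> fail_rate a = 1 - a / eta"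
  using eta_pos by (simp add: fail_rate_def field_simps)

lemma fail_rate_eq_half: "a \<le> eta / 2 \<Longrightarrow> fail_rate a = 1 / 2"
  using eta_pos by (simp add: fail_rate_def field_simps)

lemma exp_less_eta_iff: "exp t < eta \<longleftrightarrow> t < ln eta"
  using eta_pos by (metis exp_less_cancel_iff exp_ln)

lemma fail_rate_exp_pos: "t < ln eta \<Longrightarrow> 0 < fail_rate (exp t)"
  by (simp add: fail_rate_pos_iff exp_less_eta_iff)

lemma prod_fail_rate_le_1: "(\<Prod>v\<in>S. fail_rate (a v)) \<le> 1"
  by (intro prod_le_1) (auto simp: fail_rate_nonneg intro: order_trans[OF fail_rate_le_half])

lemma cost_mono:
  assumes "s \<le> t" "t < ln eta"
  shows "cost s \<le> cost t"
  unfolding cost_def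
  using assms fail_rate_exp_pos[of t] by (intro le_imp_neg_le ln_mono fail_rate_antimono) auto

lemma ln2_le_cost: "t < ln eta \<Longrightarrow> ln 2 \<le> cost t"
  using fail_rate_le_half[of "exp t"] fail_rate_exp_pos[of t]
    ln_mono[of "fail_rate (exp t)" "1 / 2"]
  by (simp add: cost_def ln_div)

lemma cost_pos: "t < ln eta \<Longrightarrow> 0 < cost t"
  using ln2_le_cost[of t] ln_gt_zero[of 2] by linarith

lemma cost_eq_ln2: "t \<le> ln (eta / 2) \<Longrightarrow> cost t = ln 2"
  using eta_pos ln_ge_iff[of "eta / 2" t] by (simp add: cost_def fail_rate_eq_half ln_div)

lemma cost_eq_minus_ln:
  assumes "ln (eta / 2) \<le> t" "t < ln eta"
  shows "cost t = - ln (1 - exp t / eta)"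
proof -
  have "eta / 2 \<le> exp t" "exp t < eta"
    using assms eta_pos ln_le_cancel_iff[of "eta / 2" "exp t"] by (auto simp: exp_less_eta_iff)
  then show ?thesis
    by (simp add: cost_def fail_rate_eq)
qed

lemma inverse_cost_integrable:
  assumes "t < ln eta"
  shows "(\<lambda>u. 1 / cost u) integrable_on {s..t}"
proof (rule integrable_continuous_real)
  have "0 < fail_rate (exp u)" "cost u \<noteq> 0" if "u \<in> {s..t}" for u
    using that assms fail_rate_exp_pos[of u] cost_pos[of u] by auto
  then show "continuous_on {s..t} (\<lambda>u. 1 / cost u)"
    unfolding cost_def fail_rate_def using eta_pos by (intro continuous_intros) force+
qed

lemma potential_diff_ge:
  assumes "0 \<le> s" "s \<le> t" "t < ln eta"
  shows "(t - s) / cost t \<le> potential t - potential s"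
proof -
  have "(t - s) / cost t = integral {s..t} (\<lambda>u. 1 / cost t)"
    using assms(2) by simp
  also have "\<dots> \<le> integral {s..t} (\<lambda>u. 1 / cost u)"
    using assms(3) cost_mono[of _ t] cost_pos
    by (intro integral_le inverse_cost_integrable) (auto intro!: divide_left_mono)
  also have "\<dots> = potential t - potential s"
    using Henstock_Kurzweil_Integration.integral_combine[OF assms(1,2)
        inverse_cost_integrable[OF assms(3)]]
    by (simp add: potential_def)
  finally show ?thesis .
qed

text \<open>The logarithmic mean of \<open>1\<close> and \<open>q\<^sup>3\<close> is at most their power mean with exponent \<open>1/3\<close>.\<close>

lemma minus_ln_ge_power_mean:
  fixes q :: real
  assumes "0 < q" "q \<le> 1"
  shows "8 * (1 - q ^ 3) / (1 + q) ^ 3 \<le> - 3 * ln q"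
proof -
  let ?f = "\<lambda>q::real. - 3 * ln q - 8 * (1 - q ^ 3) / (1 + q) ^ 3"
  have "?f 1 \<le> ?f q"
  proof (rule DERIV_nonpos_imp_nonincreasing[OF assms(2)])
    fix r assume r: "q \<le> r" "r \<le> 1"
    then have "0 < r"
      using assms(1) by simp
    then have "(?f has_real_derivative (- 3 / r - (- 24 * r ^ 2 * (1 + r) ^ 3
        - 8 * (1 - r ^ 3) * (3 * (1 + r) ^ 2)) / ((1 + r) ^ 3 * (1 + r) ^ 3))) (at r)"
      by (auto intro!: derivative_eq_intros)
    also have "- 24 * r ^ 2 * (1 + r) ^ 3 - 8 * (1 - r ^ 3) * (3 * (1 + r) ^ 2)
        = - 24 * (1 + r ^ 2) * (1 + r) ^ 2"
      by algebra
    also have "(1 + r) ^ 3 * (1 + r) ^ 3 = (1 + r) ^ 4 * (1 + r) ^ 2"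
      by (simp flip: power_add)
    also have "- 24 * (1 + r ^ 2) * (1 + r) ^ 2 / ((1 + r) ^ 4 * (1 + r) ^ 2)
        = - 24 * (1 + r ^ 2) / (1 + r) ^ 4"
      by (rule mult_divide_mult_cancel_right) (use \<open>0 < r\<close> in simp)
    also have "- 3 / r - - 24 * (1 + r ^ 2) / (1 + r) ^ 4
        = (- 3 * (1 + r) ^ 4 - - 24 * (1 + r ^ 2) * r) / (r * (1 + r) ^ 4)"
      by (rule diff_frac_eq) (use \<open>0 < r\<close> in auto)
    also have "- 3 * (1 + r) ^ 4 - - 24 * (1 + r ^ 2) * r = - 3 * (1 - r) ^ 4"
      by algebra
    finally have "(?f has_real_derivative - 3 * (1 - r) ^ 4 / (r * (1 + r) ^ 4)) (at r)" .
    moreover have "- 3 * (1 - r) ^ 4 / (r * (1 + r) ^ 4) \<le> 0"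
      using \<open>0 < r\<close> by (simp add: divide_simps)
    ultimately show "\<exists>y. (?f has_real_derivative y) (at r) \<and> y \<le> 0"
      by blast
  qed
  then show ?thesis by simp
qed

text \<open>With \<open>q = fail_cbrt u\<close>, so that \<open>cost u = - 3 * ln q\<close>, this inequality bounds \<open>du / cost u\<close> by
  the negative of \<open>3 q\<^sup>2 (1 + q)\<^sup>3 / (8 (1 - q\<^sup>3)\<^sup>2) dq\<close>. The antiderivative of the latter is
  elementary but involves \<open>arctan\<close>, which comes from integrating \<open>(1 + 3 q) / (1 + q + q\<^sup>2)\<close>.
  Replacing this fraction by a quartic that touches it from below at \<open>1/7\<close> and \<open>1/2\<close> avoids the
  \<open>arctan\<close>.\<close>

definition fail_cbrt :: "real \<Rightarrow> real" where
  "fail_cbrt u = exp (ln (1 - exp u / eta) / 3)"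

definition quartic_minorant :: "real \<Rightarrow> real" where
  "quartic_minorant q
    = (105969 + 215856 * q - 348277 * q ^ 2 + 229012 * q ^ 3 - 61348 * q ^ 4) / 106134"

definition quartic_minorant_integral :: "real \<Rightarrow> real" where
  "quartic_minorant_integral q = (105969 * q + 107928 * q ^ 2 - 348277 / 3 * q ^ 3 + 57253 * q ^ 4
     - 61348 / 5 * q ^ 5) / 106134"

definition tail_bound :: "real \<Rightarrow> real" where
  "tail_bound q = ((2 + 3 * q + 3 * q ^ 2) / (1 - q ^ 3) - 2 + 4 * ln (1 - q ^ 3)
     - 3 * quartic_minorant_integral q) / 8"

lemma quartic_minorant_le: "quartic_minorant q \<le> (1 + 3 * q) / (1 + q + q ^ 2)"
proof -
  have "0 < 1 + q + q ^ 2"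
    using zero_le_power2[of "q + 1 / 2"] by (simp add: power2_eq_square algebra_simps)
  have "0 \<le> 165 - 453 * q + 313 * q ^ 2"
    using zero_le_power2[of "626 * q - 453"] by (simp add: power2_eq_square algebra_simps)
  then have "0 \<le> ((7 * q - 1) * (2 * q - 1)) ^ 2 * (165 - 453 * q + 313 * q ^ 2) / 106134"
    by simp
  also have "\<dots> = 1 + 3 * q - quartic_minorant q * (1 + q + q ^ 2)"
    unfolding quartic_minorant_def by (simp add: field_simps) algebra
  finally show ?thesis
    using \<open>0 < 1 + q + q ^ 2\<close> by (simp add: pos_le_divide_eq)
qed

lemma tail_bound_deriv:
  assumes "0 \<le> q" "q < 1"
  shows "\<exists>D\<ge>3 * q ^ 2 * (1 + q) ^ 3 / (8 * (1 - q ^ 3) ^ 2).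
    (tail_bound has_real_derivative D) (at q)"
proof -
  have "q ^ 3 < 1"
    using assms power_less_one_iff[of q 3] by simp
  have "1 + q + q ^ 2 \<noteq> 0"
    using assms(1) by (simp add: add_nonneg_eq_0_iff)
  define d where "d = 1 - q ^ 3"
  have "d \<noteq> 0"
    using \<open>q ^ 3 < 1\<close> by (simp add: d_def)
  let ?num = "(3 + 6 * q) * d + (2 + 3 * q + 3 * q ^ 2) * (3 * q ^ 2)"
  have "(quartic_minorant_integral has_real_derivative quartic_minorant q) (at q)"
    unfolding quartic_minorant_integral_def quartic_minorant_def
    by (auto intro!: derivative_eq_intros)
  then have "(tail_bound has_real_derivative
      (?num / d ^ 2 - 12 * q ^ 2 / d - 3 * quartic_minorant q) / 8) (at q)"
    unfolding tail_bound_def d_def using \<open>q ^ 3 < 1\<close>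
    by (auto intro!: derivative_eq_intros simp: power2_eq_square)
  moreover have "(?num / d ^ 2 - 12 * q ^ 2 / d - 3 * quartic_minorant q) / 8
      = 3 * q ^ 2 * (1 + q) ^ 3 / (8 * d ^ 2)
        + 3 / 8 * ((1 + 3 * q) / (1 + q + q ^ 2) - quartic_minorant q)"
  proof -
    have "(1 + 3 * q) / (1 + q + q ^ 2) = (1 + 3 * q) * (1 - q) * d / d ^ 2" (is "?g = _")
      using \<open>d \<noteq> 0\<close> \<open>1 + q + q ^ 2 \<noteq> 0\<close> unfolding d_def by (simp add: frac_eq_eq) algebra
    moreover have "?num / d ^ 2 - 12 * q ^ 2 / d = (?num - 12 * q ^ 2 * d) / d ^ 2"
      using \<open>d \<noteq> 0\<close> by (simp add: diff_divide_distrib power2_eq_square)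
    moreover have "?num - 12 * q ^ 2 * d
        = 3 * q ^ 2 * (1 + q) ^ 3 + 3 * ((1 + 3 * q) * (1 - q) * d)"
      unfolding d_def by algebra
    ultimately have "?num / d ^ 2 - 12 * q ^ 2 / d = 3 * q ^ 2 * (1 + q) ^ 3 / d ^ 2 + 3 * ?g"
      by (simp only: add_divide_distrib times_divide_eq_right)
    then show ?thesis
      by argo
  qed
  moreover have "0 \<le> 3 / 8 * ((1 + 3 * q) / (1 + q + q ^ 2) - quartic_minorant q)"
    using quartic_minorant_le[of q] by (simp del: times_divide_eq_right times_divide_eq_left)
  ultimately show ?thesis
    unfolding d_def by (metis le_add_same_cancel1)
qed

lemma tail_bound_nonneg:
  assumes "0 \<le> q" "q < 1"
  shows "0 \<le> tail_bound q"
proof -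
  have "tail_bound 0 \<le> tail_bound q"
  proof (rule DERIV_nonneg_imp_nondecreasing[OF assms(1)])
    fix r assume "0 \<le> r" "r \<le> q"
    then show "\<exists>D. (tail_bound has_real_derivative D) (at r) \<and> 0 \<le> D"
      using tail_bound_deriv[of r] assms(2) by (force intro: order_trans[rotated])
  qed
  then show ?thesis
    by (simp add: tail_bound_def quartic_minorant_integral_def)
qed

lemma fail_cbrt_power3:
  assumes "u < ln eta"
  shows "fail_cbrt u ^ 3 = 1 - exp u / eta"
proof -
  have "0 < 1 - exp u / eta"
    using assms eta_pos by (simp add: exp_less_eta_iff)
  then show ?thesis
    using exp_of_nat_mult[of 3 "ln (1 - exp u / eta) / 3"] by (simp add: fail_cbrt_def)
qed

lemma fail_cbrt_bounds:
  assumes "u < ln eta"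
  shows "0 < fail_cbrt u" "fail_cbrt u < 1"
  using assms eta_pos by (simp_all add: fail_cbrt_def exp_less_eta_iff)

lemma fail_cbrt_deriv:
  assumes "u < ln eta"
  shows "(fail_cbrt has_real_derivative - ((1 - fail_cbrt u ^ 3) / (3 * fail_cbrt u ^ 2))) (at u)"
proof -
  define w where "w = 1 - exp u / eta"
  have "0 < w"
    using assms eta_pos by (simp add: w_def exp_less_eta_iff)
  then have "(fail_cbrt has_real_derivative - (fail_cbrt u * ((1 - w) / w) / 3)) (at u)"
    using eta_pos unfolding fail_cbrt_def w_def by (auto intro!: derivative_eq_intros)
  also have "w = fail_cbrt u ^ 3"
    using assms by (simp add: w_def fail_cbrt_power3)
  also have "fail_cbrt u * ((1 - fail_cbrt u ^ 3) / fail_cbrt u ^ 3) / 3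
      = (1 - fail_cbrt u ^ 3) / (3 * fail_cbrt u ^ 2)"
    using fail_cbrt_bounds(1)[OF assms] by (simp add: power2_eq_square power3_eq_cube)
  finally show ?thesis .
qed

lemma tail_bound_fail_cbrt_deriv:
  assumes "ln (eta / 2) \<le> u" "u < ln eta"
  shows "\<exists>D\<ge>1 / cost u. ((\<lambda>u. - tail_bound (fail_cbrt u)) has_real_derivative D) (at u)"
proof -
  define q where "q = fail_cbrt u"
  have q: "0 < q" "q < 1"
    using fail_cbrt_bounds[OF assms(2)] by (simp_all add: q_def)
  then have "q ^ 3 < 1"
    using power_less_one_iff[of q 3] by simp
  obtain D where D: "3 * q ^ 2 * (1 + q) ^ 3 / (8 * (1 - q ^ 3) ^ 2) \<le> D"
    "(tail_bound has_real_derivative D) (at q)"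
    using tail_bound_deriv[of q] q by auto
  have "((\<lambda>u. - tail_bound (fail_cbrt u)) has_real_derivative
      D * ((1 - q ^ 3) / (3 * q ^ 2))) (at u)"
    using DERIV_minus[OF DERIV_chain2[OF D(2)[unfolded q_def] fail_cbrt_deriv[OF assms(2)]]]
    by (simp add: q_def)
  moreover have "1 / cost u \<le> D * ((1 - q ^ 3) / (3 * q ^ 2))"
  proof -
    have "cost u = - 3 * ln q"
      using assms by (simp add: cost_eq_minus_ln q_def fail_cbrt_def)
    then have "1 / cost u \<le> (1 + q) ^ 3 / (8 * (1 - q ^ 3))"
      using minus_ln_ge_power_mean[of q] q \<open>q ^ 3 < 1\<close> by (simp add: field_simps)
    also have "\<dots> = 3 * q ^ 2 * (1 + q) ^ 3 / (8 * (1 - q ^ 3) ^ 2) * ((1 - q ^ 3) / (3 * q ^ 2))"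
      using q \<open>q ^ 3 < 1\<close> by (simp add: power2_eq_square)
    also have "\<dots> \<le> D * ((1 - q ^ 3) / (3 * q ^ 2))"
      using D(1) \<open>q ^ 3 < 1\<close> by (intro mult_right_mono) auto
    finally show ?thesis .
  qed
  ultimately show ?thesis by blast
qed

lemma integral_inverse_cost_le:
  assumes "ln (eta / 2) \<le> t" "t < ln eta"
  shows "integral {ln (eta / 2)..t} (\<lambda>u. 1 / cost u) \<le> tail_bound (exp (- ln 2 / 3))"
proof -
  let ?T = "\<lambda>u. - tail_bound (fail_cbrt u)" and ?I = "{ln (eta / 2)..t}"
  have "\<forall>u\<in>?I. \<exists>D\<ge>1 / cost u. (?T has_real_derivative D) (at u)"
    using tail_bound_fail_cbrt_deriv assms(2) by auto
  from bchoice[OF this] obtain D where D: "\<And>u. u \<in> ?I \<Longrightarrow> 1 / cost u \<le> D u"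
    "\<And>u. u \<in> ?I \<Longrightarrow> (?T has_real_derivative D u) (at u)"
    by blast
  have "(D has_integral (?T t - ?T (ln (eta / 2)))) ?I"
  proof (rule fundamental_theorem_of_calculus[OF assms(1)])
    fix u assume "u \<in> ?I"
    then show "(?T has_vector_derivative D u) (at u within ?I)"
      using D(2) has_field_derivative_at_within has_real_derivative_iff_has_vector_derivative
      by blast
  qed
  then have "integral ?I (\<lambda>u. 1 / cost u) \<le> ?T t - ?T (ln (eta / 2))"
    using inverse_cost_integrable[OF assms(2)] D(1)
    by (intro has_integral_le[OF integrable_integral])
  moreover have "?T t \<le> 0"
    using fail_cbrt_bounds[OF assms(2)] by (simp add: tail_bound_nonneg)
  moreover have "fail_cbrt (ln (eta / 2)) = exp (- ln 2 / 3)"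
    using eta_pos exp_ln[of "eta / 2"] by (simp add: fail_cbrt_def ln_div[of 1 2])
  ultimately show ?thesis by simp
qed

lemma ln_half_eta_less: "ln (eta / 2) < 65 / 152 * ln 2"
proof -
  have "152 * ln (eta / 2) = ln ((eta / 2) ^ 152)"
    using eta_pos by (simp add: ln_realpow)
  also have "\<dots> < ln (2 ^ 65)"
  proof (subst ln_less_cancel_iff)
    have "(eta / 2) ^ 152 = ((eta / 2) ^ 19) ^ 8"
      by (simp flip: power_mult)
    also have "\<dots> \<le> (2791 / 10) ^ 8"
      by (intro power_mono) (simp_all add: eta_def power_divide)
    also have "\<dots> < 2 ^ 65"
      by (simp add: power_divide)
    finally show "(eta / 2) ^ 152 < 2 ^ 65" .
  qed (use eta_pos in simp_all)
  also have "\<dots> = 65 * ln 2"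
    by (subst ln_realpow) auto
  finally show ?thesis by simp
qed

lemma tail_bound_less: "tail_bound (exp (- ln 2 / 3)) < 87 / 152"
proof -
  define q :: real where "q = exp (- ln 2 / 3)"
  have q3: "q ^ 3 = 1 / 2"
    using exp_of_nat_mult[of 3 "- ln 2 / 3 :: real"] by (simp add: q_def exp_minus)
  have "(7937 / 10000) ^ 3 \<le> q ^ 3" "q ^ 3 \<le> (79371 / 100000) ^ 3"
    by (simp_all add: q3 power_divide)
  then have q: "7937 / 10000 \<le> q" "q \<le> 79371 / 100000"
    by (simp_all add: q_def)
  have q2: "62995 / 100000 \<le> q ^ 2" "q ^ 2 \<le> 62998 / 100000"
    using power_mono[OF q(1), of 2] power_mono[OF q(2), of 2] q(1) by (simp_all add: power_divide)
  have ln2: "69314 / 100000 \<le> ln (2 :: real)"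
    using ln_approx_bounds[of 2 6] by (simp add: eval_nat_numeral)
  have "q ^ 4 = q / 2" "q ^ 5 = q ^ 2 / 2"
    using q3 by algebra+
  then have "tail_bound q = (2 * (2 + 3 * q + 3 * q ^ 2) - 2 - 4 * ln 2
      - 3 * ((105969 * q + 107928 * q ^ 2 - 348277 / 6 + 57253 / 2 * q - 61348 / 10 * q ^ 2)
        / 106134)) / 8"
    by (simp add: tail_bound_def quartic_minorant_integral_def q3 ln_div)
  also have "\<dots> < 87 / 152"
    using q q2 ln2 by argo
  finally show ?thesis
    by (simp add: q_def)
qed

lemma potential_less_1:
  assumes "0 \<le> t" "t < ln eta"
  shows "potential t < 1"
proof -
  have potential_initial: "potential s = s / ln 2" if "0 \<le> s" "s \<le> ln (eta / 2)" for s
  proof -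
    have "potential s = integral {0..s} (\<lambda>u. 1 / ln 2)"
      unfolding potential_def using that by (intro integral_cong) (simp add: cost_eq_ln2)
    then show ?thesis
      using that(1) by simp
  qed
  have "ln (eta / 2) / ln 2 < 65 / 152"
    using ln_half_eta_less by (simp add: divide_less_eq)
  show ?thesis
  proof (cases "t \<le> ln (eta / 2)")
    case True
    then have "potential t \<le> ln (eta / 2) / ln 2"
      using assms(1) by (simp add: potential_initial divide_right_mono)
    then show ?thesis
      using \<open>ln (eta / 2) / ln 2 < 65 / 152\<close> by linarith
  next
    case False
    have "0 \<le> ln (eta / 2)"
      by (simp add: eta_def)
    then have "potential t = ln (eta / 2) / ln 2 + integral {ln (eta / 2)..t} (\<lambda>u. 1 / cost u)"
      using False potential_initial[of "ln (eta / 2)"] inverse_cost_integrable[OF assms(2), of 0]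
        Henstock_Kurzweil_Integration.integral_combine[of 0 "ln (eta / 2)" t "\<lambda>u. 1 / cost u"]
      by (simp add: potential_def)
    also have "\<dots> < 65 / 152 + 87 / 152"
      using \<open>ln (eta / 2) / ln 2 < 65 / 152\<close> integral_inverse_cost_le[of t] tail_bound_less
        False assms(2) by linarith
    finally show ?thesis by simp
  qed
qed

section \<open>Truncation\<close>

lemma minus_ln_div_less:
  fixes a q :: real and k :: nat
  assumes "0 < k" "0 < a" "0 < q" and "1 < a ^ k * q"
  shows "- ln q / k < ln a"
proof -
  have "0 < ln (a ^ k * q)"
    using assms(4) by simp
  also have "\<dots> = k * ln a + ln q"
    using ln_mult_pos[of "a ^ k" q] assms(2,3) by (simp add: ln_realpow)
  finally show ?thesis
    using assms(1) by (subst pos_divide_less_eq) (auto simp: mult.commute)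
qed

lemma inverse_le_potential_diff:
  fixes k :: nat
  assumes "0 < k" "0 \<le> s" "t < ln eta" and "cost t / k \<le> t - s"
  shows "1 / k \<le> potential t - potential s"
proof -
  have "0 < cost t"
    using assms(3) by (rule cost_pos)
  then have "0 \<le> cost t / k"
    by simp
  then have "s \<le> t"
    using assms(4) by linarith
  have "1 / k = cost t / k / cost t"
    using \<open>0 < cost t\<close> by simp
  also have "\<dots> \<le> (t - s) / cost t"
    using assms(4) \<open>0 < cost t\<close> by (intro divide_right_mono) auto
  also have "\<dots> \<le> potential t - potential s"
    using assms(2) \<open>s \<le> t\<close> assms(3) by (rule potential_diff_ge)
  finally show ?thesis .
qed

lemma potential_increment:
  assumes "0 < k" and "0 \<le> a" "0 < p" "p \<le> 1" and large: "1 < a ^ k * (fail_rate a * p)"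
  shows "0 < fail_rate a * p" "- ln (fail_rate a * p) / k < ln eta"
    and "1 / k \<le> potential (- ln (fail_rate a * p) / k) - potential (- ln p / k)"
proof -
  define s t where "s = - ln p / k" and "t = - ln (fail_rate a * p) / k"
  show pos: "0 < fail_rate a * p"
    using large assms(3) fail_rate_nonneg[of a] by (cases "fail_rate a = 0") auto
  then have "0 < fail_rate a"
    using assms(3) by (simp add: zero_less_mult_iff)
  have "0 < a"
    using large assms(1,2) by (cases "a = 0") (auto simp: power_0_left)
  have "t < ln a"
    using minus_ln_div_less[OF assms(1) \<open>0 < a\<close> pos large] by (simp add: t_def)
  moreover have "ln a < ln eta"
    using \<open>0 < fail_rate a\<close> \<open>0 < a\<close> eta_pos by (simp add: fail_rate_pos_iff)
  ultimately have "t < ln eta" by simp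
  then show "- ln (fail_rate a * p) / k < ln eta"
    by (simp add: t_def)
  have "exp t \<le> a"
    using \<open>t < ln a\<close> \<open>0 < a\<close> by (simp add: less_imp_le flip: ln_ge_iff)
  then have "cost t \<le> - ln (fail_rate a)"
    using \<open>0 < fail_rate a\<close> by (simp add: cost_def fail_rate_antimono ln_mono)
  then have "cost t / k \<le> - ln (fail_rate a) / k"
    by (intro divide_right_mono) auto
  also have "\<dots> = t - s"
    using \<open>0 < fail_rate a\<close> \<open>0 < p\<close> by (simp add: s_def t_def ln_mult_pos diff_divide_distrib)
  finally have "1 / k \<le> potential t - potential s"
    using assms(1,3,4) \<open>t < ln eta\<close>
    by (intro inverse_le_potential_diff) (simp_all add: s_def divide_nonpos_nonneg)
  then show "1 / k \<le> potential (- ln (fail_rate a * p) / k) - potential (- ln p / k)"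
    by (simp add: s_def t_def)
qed

text \<open>Removing from \<open>S\<close> the element that witnesses the assumption for \<open>S' = S\<close> lowers the potential
  by at least \<open>1 / k\<close>.\<close>

lemma potential_ge_card:
  fixes a :: "'a \<Rightarrow> real" and k :: nat
  assumes "0 < k" "finite S" and "\<And>u. u \<in> S \<Longrightarrow> 0 \<le> a u"
    and "\<And>S'. S' \<subseteq> S \<Longrightarrow> S' \<noteq> {} \<Longrightarrow> \<exists>u\<in>S'. 1 < a u ^ k * (\<Prod>v\<in>S'. fail_rate (a v))"
  defines "t \<equiv> - ln (\<Prod>v\<in>S. fail_rate (a v)) / k"
  shows "0 < (\<Prod>v\<in>S. fail_rate (a v)) \<and> t < ln eta \<and> card S / k \<le> potential t"
  using assms(2-4) unfolding t_def
proof (induction S rule: finite_psubset_induct)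
  case (psubset S)
  show ?case
  proof (cases "S = {}")
    case True
    then show ?thesis by (simp add: potential_def eta_def)
  next
    case False
    then obtain u where u: "u \<in> S" "1 < a u ^ k * (\<Prod>v\<in>S. fail_rate (a v))"
      using psubset.prems(2)[of S] by blast
    define p where "p = (\<Prod>v\<in>S - {u}. fail_rate (a v))"
    have S: "(\<Prod>v\<in>S. fail_rate (a v)) = fail_rate (a u) * p" "card S = Suc (card (S - {u}))"
      using prod.remove[OF \<open>finite S\<close> u(1)] card.remove[OF \<open>finite S\<close> u(1)]
      by (simp_all add: p_def)
    have "0 < p" and IH: "card (S - {u}) / k \<le> potential (- ln p / k)"
      using psubset.IH[of "S - {u}"] psubset.prems u(1) unfolding p_def by blast+
    have "p \<le> 1"
      unfolding p_def by (rule prod_fail_rate_le_1)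
    note increment = potential_increment[OF \<open>0 < k\<close> psubset.prems(1)[OF u(1)] \<open>0 < p\<close> \<open>p \<le> 1\<close>
        u(2)[unfolded S(1)]]
    have "card S / k = card (S - {u}) / k + 1 / k"
      by (simp add: S(2) add_divide_distrib)
    then show ?thesis
      unfolding S(1) using IH increment by auto
  qed
qed

lemma truncation_exists:
  fixes a :: "'a \<Rightarrow> real"
  assumes "finite D" "card D = k" "0 < k" and nonneg: "\<And>u. u \<in> D \<Longrightarrow> 0 \<le> a u"
  shows "\<exists>D'\<subseteq>D. D' \<noteq> {} \<and> (\<forall>u\<in>D'. a u ^ k * (\<Prod>v\<in>D'. fail_rate (a v)) \<le> 1)"
proof (rule ccontr)
  define p where "p = (\<Prod>v\<in>D. fail_rate (a v))"
  assume "\<not> ?thesis"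
  then have "\<exists>u\<in>S. 1 < a u ^ k * (\<Prod>v\<in>S. fail_rate (a v))" if "S \<subseteq> D" "S \<noteq> {}" for S
    using that by (meson not_le)
  from potential_ge_card[OF \<open>0 < k\<close> \<open>finite D\<close> nonneg this]
  have "0 < p" "- ln p / k < ln eta" "1 \<le> potential (- ln p / k)"
    using assms(2,3) by (simp_all add: p_def)
  moreover have "p \<le> 1"
    unfolding p_def by (rule prod_fail_rate_le_1)
  ultimately show False
    using potential_less_1[of "- ln p / k"] \<open>0 < k\<close> by (simp add: divide_nonpos_nonneg)
qed

section \<open>The lower bound\<close>

definition conflict_degree :: "'v cnf \<Rightarrow> 'v clause \<Rightarrow> nat" where
  "conflict_degree F C = card {D\<in>F. conflict C D}"

definition occ :: "'v cnf \<Rightarrow> 'v literal \<Rightarrow> nat" where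
  "occ F l = card {C\<in>F. l \<in> C}"

lemma conflict_commute: "conflict C D \<longleftrightarrow> conflict D C"
  by (auto simp: conflict_def)

lemma conflict_irrefl: "is_clause C \<Longrightarrow> \<not> conflict C C"
  by (auto simp: is_clause_def conflict_def)

lemma conflict_degree_eq_card_edges:
  assumes "is_cnf F" "C \<in> F"
  shows "conflict_degree F C = card {e \<in> conflict_edges F. C \<in> e}"
  unfolding conflict_degree_def
proof (rule bij_betw_same_card)
  have neq: "C \<noteq> D" if "conflict C D" for D
    using assms that conflict_irrefl by (auto simp: is_cnf_def)
  have "{e \<in> conflict_edges F. C \<in> e} = (\<lambda>D. {C, D}) ` {D\<in>F. conflict C D}"
    using assms(2) neq conflict_commute by (fastforce simp: conflict_edges_def)
  then show "bij_betw (\<lambda>D. {C, D}) {D\<in>F. conflict C D} {e \<in> conflict_edges F. C \<in> e}"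
    by (auto simp: bij_betw_def inj_on_def doubleton_eq_iff)
qed

lemma sum_conflict_degree:
  assumes "is_cnf F"
  shows "(\<Sum>C\<in>F. conflict_degree F C) = 2 * num_conflicts F"
proof -
  have "finite F"
    using assms by (simp add: is_cnf_def)
  moreover have "finite (conflict_edges F)"
    by (rule finite_subset[of _ "Pow F"]) (use \<open>finite F\<close> in \<open>auto simp: conflict_edges_def\<close>)
  moreover have "card {C\<in>F. C \<in> e} = 2" if "e \<in> conflict_edges F" for e
  proof -
    obtain C D where "e = {C, D}" "C \<in> F" "D \<in> F" "C \<noteq> D"
      using \<open>e \<in> conflict_edges F\<close> by (auto simp: conflict_edges_def)
    then have "{C\<in>F. C \<in> e} = {C, D}" by auto
    then show ?thesis using \<open>C \<noteq> D\<close> by simp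
  qed
  ultimately have "(\<Sum>C\<in>F. card {e \<in> conflict_edges F. C \<in> e}) = 2 * num_conflicts F"
    unfolding num_conflicts_def by (intro sum_multicount) auto
  then show ?thesis
    using assms by (simp add: conflict_degree_eq_card_edges)
qed

lemma sum_occ_compl_le:
  assumes "finite F" "finite C"
  shows "(\<Sum>l\<in>C. occ F (compl_lit l)) \<le> card C * conflict_degree F C"
proof -
  have "(\<Sum>l\<in>C. occ F (compl_lit l)) = (\<Sum>D\<in>F. card {l\<in>C. compl_lit l \<in> D})"
    unfolding occ_def using assms by (intro sum_multicount_gen) auto
  also have "\<dots> \<le> (\<Sum>D\<in>F. if conflict C D then card C else 0)"
    using assms(2) by (intro sum_mono) (auto simp: conflict_iff intro: card_mono)
  also have "\<dots> = card C * conflict_degree F C"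
    using assms(1) by (simp add: conflict_degree_def sum.If_cases Int_def)
  finally show ?thesis .
qed

definition max_occ :: "'v cnf \<Rightarrow> 'v \<Rightarrow> nat" where
  "max_occ F x = max (occ F (Pos x)) (occ F (Neg x))"

definition level :: "nat \<Rightarrow> 'v cnf \<Rightarrow> 'v \<Rightarrow> real" where
  "level k F x = root k (8 * real k * max_occ F x)"

definition bias :: "nat \<Rightarrow> 'v cnf \<Rightarrow> 'v \<Rightarrow> bool pmf" where
  "bias k F x = bernoulli_pmf
     (if occ F (Neg x) \<le> occ F (Pos x) then 1 - fail_rate (level k F x)
      else fail_rate (level k F x))"

definition risky :: "('v \<Rightarrow> bool pmf) \<Rightarrow> 'v clause \<Rightarrow> bool" where
  "risky p C \<longleftrightarrow> (\<exists>l\<in>C. 1 / 2 < lit_fail p l)"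

lemma level_nonneg: "0 \<le> level k F x"
  by (cases "k = 0") (auto simp: level_def)

lemma level_power: "0 < k \<Longrightarrow> level k F x ^ k = 8 * real k * max_occ F x"
  by (simp add: level_def)

lemma occ_le_max_occ: "occ F l \<le> max_occ F (lit_var l)"
  by (cases l) (auto simp: max_occ_def)

lemma lit_fail_bias_cases:
  obtains "lit_fail (bias k F) l = fail_rate (level k F (lit_var l))"
  | "lit_fail (bias k F) l = 1 - fail_rate (level k F (lit_var l))"
    "max_occ F (lit_var l) = occ F (compl_lit l)"
proof -
  have "0 \<le> fail_rate a" "fail_rate a \<le> 1" for a
    using fail_rate_nonneg order_trans[OF fail_rate_le_half, of 1] by auto
  then have "lit_fail (bias k F) l = fail_rate (level k F (lit_var l)) \<or>
      lit_fail (bias k F) l = 1 - fail_rate (level k F (lit_var l)) \<and>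
      max_occ F (lit_var l) = occ F (compl_lit l)"
    by (cases l) (simp_all add: lit_fail_def bias_def max_occ_def)
  then show ?thesis
    using that by blast
qed

lemma lit_fail_bias_gt_half:
  assumes "1 / 2 < lit_fail (bias k F) l"
  shows "lit_fail (bias k F) l \<le> level k F (lit_var l) / eta"
    and "max_occ F (lit_var l) = occ F (compl_lit l)"
proof -
  let ?a = "level k F (lit_var l)"
  have minority: "lit_fail (bias k F) l = 1 - fail_rate ?a"
      "max_occ F (lit_var l) = occ F (compl_lit l)"
    using assms fail_rate_le_half[of ?a] by (cases rule: lit_fail_bias_cases[of k F l]; simp)+
  then have "fail_rate ?a < 1 / 2"
    using assms by simp
  then have "1 - ?a / eta \<le> fail_rate ?a"
    by (auto simp: fail_rate_def)
  then show "lit_fail (bias k F) l \<le> ?a / eta" "max_occ F (lit_var l) = occ F (compl_lit l)"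
    using minority by simp_all
qed

lemma lit_fail_bias_safe:
  assumes "\<not> risky (bias k F) C" "l \<in> C"
  shows "lit_fail (bias k F) l = fail_rate (level k F (lit_var l))"
  using assms fail_rate_le_half[of "level k F (lit_var l)"]
  by (cases rule: lit_fail_bias_cases[of k F l]) (force simp: risky_def)+

lemma clause_fail_risky_le:
  assumes "0 < k" "card C = k" and risky: "risky (bias k F) C"
  shows "clause_fail (bias k F) C \<le> 8 * real k / eta ^ k * (\<Sum>l\<in>C. occ F (compl_lit l))"
proof -
  let ?fail = "lit_fail (bias k F)"
  have "finite C" "C \<noteq> {}"
    using assms(1,2) by (auto intro: card_ge_0_finite)
  then have "Max (?fail ` C) \<in> ?fail ` C"
    by simp
  then obtain l where "l \<in> C" "Max (?fail ` C) = ?fail l"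
    by blast
  then have l: "l \<in> C" "\<And>m. m \<in> C \<Longrightarrow> ?fail m \<le> ?fail l"
    using \<open>finite C\<close> Max_ge[of "?fail ` C"] by auto
  then have "1 / 2 < ?fail l"
    using risky by (force simp: risky_def)
  note l_bounds = lit_fail_bias_gt_half[OF this]
  have "clause_fail (bias k F) C \<le> (\<Prod>m\<in>C. level k F (lit_var l) / eta)"
    unfolding clause_fail_def
    using l(2) l_bounds(1) by (intro prod_mono) (auto simp: lit_fail_nonneg intro: order_trans)
  also have "\<dots> = 8 * real k / eta ^ k * occ F (compl_lit l)"
    using assms(1,2) l_bounds(2) by (simp add: power_divide level_power)
  also have "\<dots> \<le> 8 * real k / eta ^ k * (\<Sum>l\<in>C. occ F (compl_lit l))"
    using l(1) \<open>finite C\<close> eta_pos by (intro mult_left_mono of_nat_mono member_le_sum) auto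
  finally show ?thesis .
qed

lemma sum_clause_fail_risky_le:
  assumes "0 < k" and F: "is_k_cnf k F" and few: "128 * real k ^ 3 * num_conflicts F \<le> eta ^ k"
  shows "(\<Sum>C | C \<in> F \<and> risky (bias k F) C. clause_fail (bias k F) C) \<le> 1 / (8 * real k)"
proof -
  let ?c = "8 * real k / eta ^ k"
  have "is_cnf F" "finite F" and clauses: "\<And>C. C \<in> F \<Longrightarrow> finite C" "\<And>C. C \<in> F \<Longrightarrow> card C = k"
    using F by (auto simp: is_k_cnf_def is_cnf_def is_clause_def)
  have "0 \<le> ?c"
    using eta_pos by simp
  have occ_le: "(\<Sum>l\<in>C. occ F (compl_lit l)) \<le> k * conflict_degree F C" if "C \<in> F" for C
    using sum_occ_compl_le[of F C] \<open>finite F\<close> clauses that by simp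
  have "(\<Sum>C | C \<in> F \<and> risky (bias k F) C. clause_fail (bias k F) C)
      \<le> (\<Sum>C | C \<in> F \<and> risky (bias k F) C. ?c * (\<Sum>l\<in>C. occ F (compl_lit l)))"
    using clause_fail_risky_le[OF assms(1) clauses(2)] by (intro sum_mono) blast
  also have "\<dots> \<le> (\<Sum>C\<in>F. ?c * (\<Sum>l\<in>C. occ F (compl_lit l)))"
    using \<open>finite F\<close> by (intro sum_mono2 mult_nonneg_nonneg \<open>0 \<le> ?c\<close>) (auto intro: sum_nonneg)
  also have "\<dots> \<le> (\<Sum>C\<in>F. ?c * (k * conflict_degree F C))"
    by (intro sum_mono mult_left_mono of_nat_mono occ_le \<open>0 \<le> ?c\<close>)
  also have "\<dots> = ?c * (k * real (\<Sum>C\<in>F. conflict_degree F C))"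
    by (simp add: sum_distrib_left)
  also have "\<dots> = ?c * (k * (2 * num_conflicts F))"
    by (simp add: sum_conflict_degree[OF \<open>is_cnf F\<close>])
  also have "\<dots> \<le> 1 / (8 * real k)"
    using few assms(1) eta_pos by (simp add: field_simps power3_eq_cube)
  finally show ?thesis .
qed

lemma safe_truncation_exists:
  assumes "0 < k" "card C = k" and safe: "\<not> risky (bias k F) C"
  shows "\<exists>C'\<subseteq>C. C' \<noteq> {} \<and> (\<forall>l\<in>C'. clause_fail (bias k F) C' * occ F l \<le> 1 / (8 * real k))"
proof -
  define a where "a l = level k F (lit_var l)" for l
  have "finite C"
    using assms(1,2) by (auto intro: card_ge_0_finite)
  then obtain C' where C': "C' \<subseteq> C" "C' \<noteq> {}"
    "\<And>l. l \<in> C' \<Longrightarrow> a l ^ k * (\<Prod>m\<in>C'. fail_rate (a m)) \<le> 1"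
    using truncation_exists[of C k a] assms(1,2) by (auto simp: a_def level_nonneg)
  have fail: "clause_fail (bias k F) C' = (\<Prod>m\<in>C'. fail_rate (a m))"
    unfolding clause_fail_def a_def using C'(1) safe
    by (intro prod.cong) (auto simp: lit_fail_bias_safe)
  have "clause_fail (bias k F) C' * occ F l \<le> 1 / (8 * real k)" if "l \<in> C'" for l
  proof -
    have "8 * real k * (clause_fail (bias k F) C' * occ F l)
        \<le> 8 * real k * (clause_fail (bias k F) C' * max_occ F (lit_var l))"
      by (intro mult_left_mono of_nat_mono occ_le_max_occ clause_fail_nonneg) auto
    also have "\<dots> = a l ^ k * clause_fail (bias k F) C'"
      using assms(1) by (simp add: a_def level_power)
    also have "\<dots> \<le> 1"
      using C'(3)[OF that] fail by simp
    finally show ?thesis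
      using assms(1) by (simp add: field_simps)
  qed
  then show ?thesis
    using C'(1,2) by blast
qed

lemma sum_conflict_le:
  fixes g :: "'i \<Rightarrow> real"
  assumes "finite I" "finite C" "\<And>i. i \<in> I \<Longrightarrow> 0 \<le> g i"
  shows "(\<Sum>i | i \<in> I \<and> conflict C (D i). g i) \<le> (\<Sum>l\<in>C. \<Sum>i | i \<in> I \<and> compl_lit l \<in> D i. g i)"
proof -
  let ?S = "SIGMA l:C. {i \<in> I. compl_lit l \<in> D i}"
  have "{i \<in> I. conflict C (D i)} = snd ` ?S"
    by (force simp: conflict_iff)
  then show ?thesis
    using assms sum_image_le[of ?S g snd] by (auto simp: sum.Sigma case_prod_unfold)
qed

lemma clauses_satisfiable_if_literal_sums_le:
  fixes C :: "'i \<Rightarrow> 'v clause"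
  assumes "finite I" and clauses: "\<And>i. i \<in> I \<Longrightarrow> is_clause (C i)"
    and nonempty: "\<And>i. i \<in> I \<Longrightarrow> C i \<noteq> {}" and card_le: "\<And>i. i \<in> I \<Longrightarrow> card (C i) \<le> k"
    and literal_sum: "\<And>l. (\<Sum>i | i \<in> I \<and> l \<in> C i. clause_fail p (C i)) \<le> 1 / (4 * real k)"
  shows "\<exists>\<alpha>. \<forall>i\<in>I. \<not> falsifies \<alpha> (C i)"
proof (rule clauses_satisfiable_if_conflict_sums_le)
  fix i assume i: "i \<in> I"
  have "finite (C i)"
    using clauses[OF i] by (simp add: is_clause_def)
  then have "0 < card (C i)"
    using nonempty[OF i] by (simp add: card_gt_0_iff)
  then have "0 < k"
    using card_le[OF i] by simp
  obtain l where "l \<in> C i"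
    using nonempty[OF i] by blast
  then have "clause_fail p (C i) \<le> (\<Sum>j | j \<in> I \<and> l \<in> C j. clause_fail p (C j))"
    using i \<open>finite I\<close> by (intro member_le_sum) (auto simp: clause_fail_nonneg)
  also have "\<dots> \<le> 1 / (4 * real k)"
    by (rule literal_sum)
  also have "\<dots> < 1 / 2"
    using \<open>0 < k\<close> by (simp add: field_simps)
  finally show "clause_fail p (C i) < 1 / 2" .
  have "(\<Sum>j | j \<in> I \<and> conflict (C i) (C j). clause_fail p (C j))
      \<le> (\<Sum>l\<in>C i. \<Sum>j | j \<in> I \<and> compl_lit l \<in> C j. clause_fail p (C j))"
    using \<open>finite I\<close> \<open>finite (C i)\<close> by (intro sum_conflict_le clause_fail_nonneg)
  also have "\<dots> \<le> card (C i) * (1 / (4 * real k))"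
    by (intro sum_bounded_above literal_sum)
  also have "\<dots> \<le> real k * (1 / (4 * real k))"
    using card_le[OF i] by (intro mult_right_mono of_nat_mono) auto
  finally show "(\<Sum>j | j \<in> I \<and> conflict (C i) (C j). clause_fail p (C j)) \<le> 1 / 4"
    using \<open>0 < k\<close> by simp
qed (use assms in auto)

lemma sum_le_if_mult_occ_le:
  fixes g :: "'v clause \<Rightarrow> real"
  assumes "finite F" "S \<subseteq> {C \<in> F. l \<in> C}" "0 \<le> \<epsilon>" and le: "\<And>C. C \<in> S \<Longrightarrow> g C * occ F l \<le> \<epsilon>"
  shows "sum g S \<le> \<epsilon>"
proof (cases "occ F l = 0")
  case True
  then have "S = {}"
    using assms(1,2) by (auto simp: occ_def)
  then show ?thesis
    using assms(3) by simp
next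
  case False
  then have "sum g S \<le> card S * (\<epsilon> / occ F l)"
    using le by (intro sum_bounded_above) (simp add: pos_le_divide_eq)
  also have "\<dots> \<le> occ F l * (\<epsilon> / occ F l)"
    unfolding occ_def using assms(1-3) by (intro mult_right_mono of_nat_mono card_mono) auto
  finally show ?thesis
    using False by simp
qed

text \<open>Only clauses outside \<open>R\<close> need to be short of occurrences: those in \<open>R\<close> are paid for by their
  total failure probability, no matter how many clauses they conflict with.\<close>

lemma satisfiable_by_truncation:
  assumes cnf: "is_cnf F" and card_le: "\<And>C. C \<in> F \<Longrightarrow> card C \<le> k"
    and subset: "\<And>C. C \<in> F \<Longrightarrow> f C \<subseteq> C" and nonempty: "\<And>C. C \<in> F \<Longrightarrow> f C \<noteq> {}"
    and R: "R \<subseteq> F" "(\<Sum>C\<in>R. clause_fail p (f C)) \<le> 1 / (8 * real k)"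
    and mult_occ_le: "\<And>C l. C \<in> F - R \<Longrightarrow> l \<in> f C \<Longrightarrow> clause_fail p (f C) * occ F l \<le> 1 / (8 * real k)"
  shows "satisfiable F"
proof -
  have "finite F" and "finite R" and clause: "\<And>C. C \<in> F \<Longrightarrow> is_clause C"
    using cnf R(1) by (auto simp: is_cnf_def intro: finite_subset)
  have literal_sum: "(\<Sum>C | C \<in> F \<and> l \<in> f C. clause_fail p (f C)) \<le> 1 / (4 * real k)" for l
  proof -
    let ?S = "{C \<in> F - R. l \<in> f C}"
    have "(\<Sum>C | C \<in> F \<and> l \<in> f C. clause_fail p (f C)) \<le> (\<Sum>C\<in>R \<union> ?S. clause_fail p (f C))"
      using \<open>finite F\<close> \<open>finite R\<close> by (intro sum_mono2) (auto simp: clause_fail_nonneg)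
    also have "\<dots> = (\<Sum>C\<in>R. clause_fail p (f C)) + (\<Sum>C\<in>?S. clause_fail p (f C))"
      using \<open>finite F\<close> \<open>finite R\<close> by (intro sum.union_disjoint) auto
    also have "\<dots> \<le> 1 / (8 * real k) + 1 / (8 * real k)"
      using \<open>finite F\<close> subset mult_occ_le
      by (intro add_mono R(2) sum_le_if_mult_occ_le[of F _ l]) auto
    finally show ?thesis by simp
  qed
  have "\<exists>\<alpha>. \<forall>C\<in>F. \<not> falsifies \<alpha> (f C)"
  proof (rule clauses_satisfiable_if_literal_sums_le[OF \<open>finite F\<close> _ nonempty _ literal_sum])
    fix C assume "C \<in> F"
    then show "is_clause (f C)" "card (f C) \<le> k"
      using clause[of C] subset[of C] card_le[of C]
      by (auto simp: is_clause_def intro: finite_subset order_trans[OF card_mono])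
  qed
  then obtain \<alpha> where "\<And>C. C \<in> F \<Longrightarrow> \<not> falsifies \<alpha> (f C)"
    by blast
  then have "satisfies \<alpha> F"
    using subset by (fastforce simp: satisfies_iff falsifies_def)
  then show ?thesis
    by (auto simp: satisfiable_def)
qed

lemma satisfiable_if_few_conflicts:
  assumes "0 < k" and F: "is_k_cnf k F" and few: "128 * real k ^ 3 * num_conflicts F \<le> eta ^ k"
  shows "satisfiable F"
proof -
  let ?p = "bias k F"
  define R where "R = {C \<in> F. risky ?p C}"
  have "\<forall>C\<in>F - R. \<exists>C'\<subseteq>C. C' \<noteq> {} \<and> (\<forall>l\<in>C'. clause_fail ?p C' * occ F l \<le> 1 / (8 * real k))"
    using F assms(1) by (auto simp: R_def is_k_cnf_def intro: safe_truncation_exists)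
  from bchoice[OF this] obtain f where f: "\<And>C. C \<in> F - R \<Longrightarrow> f C \<subseteq> C \<and> f C \<noteq> {}"
    "\<And>C l. C \<in> F - R \<Longrightarrow> l \<in> f C \<Longrightarrow> clause_fail ?p (f C) * occ F l \<le> 1 / (8 * real k)"
    by blast
  show ?thesis
  proof (rule satisfiable_by_truncation[where f = "\<lambda>C. if C \<in> R then C else f C"])
    show "(\<Sum>C\<in>R. clause_fail ?p (if C \<in> R then C else f C)) \<le> 1 / (8 * real k)"
      using sum_clause_fail_risky_le[OF assms] by (simp add: R_def)
  qed (use F f in \<open>auto simp: is_k_cnf_def R_def risky_def split: if_splits\<close>)
qed

theorem num_conflicts_ge:
  "\<exists>c::real. 0 < c \<and> (\<forall>k\<ge>1. \<forall>F :: 'v cnf. is_k_cnf k F \<and> \<not> satisfiable F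
     \<longrightarrow> c * 2.69 ^ k \<le> num_conflicts F)"
proof -
  obtain B where B: "0 < B" "\<And>k. real k ^ 3 * 2.69 ^ k \<le> B * eta ^ k"
    using polynomial_times_power_le[of "2.69" eta 3] by (auto simp: eta_def)
  have "1 / (128 * B) * 2.69 ^ k \<le> num_conflicts F"
    if "1 \<le> k" "is_k_cnf k F" "\<not> satisfiable F" for k and F :: "'v cnf"
  proof -
    have "eta ^ k \<le> 128 * real k ^ 3 * num_conflicts F"
      using satisfiable_if_few_conflicts[of k F] that by force
    then have "real k ^ 3 * 2.69 ^ k \<le> B * (128 * real k ^ 3 * num_conflicts F)"
      using B(1) order_trans[OF B(2) mult_left_mono] by simp
    also have "\<dots> = real k ^ 3 * (128 * B * num_conflicts F)"
      by simp
    finally have "2.69 ^ k \<le> 128 * B * num_conflicts F"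
      using that(1) by (subst (asm) mult_le_cancel_left_pos) auto
    then show ?thesis
      using B(1) by (simp add: field_simps)
  qed
  then show ?thesis
    using B(1) by (intro exI[of _ "1 / (128 * B)"]) auto
qed

section \<open>The upper bound\<close>

lemma popular_element_exists:
  fixes \<delta> :: real
  assumes "finite U" "finite A" "A \<noteq> {}"
    and hit: "\<And>b. b \<in> U \<Longrightarrow> \<delta> * card A \<le> card {c\<in>A. R c b}"
  shows "\<exists>c\<in>A. \<delta> * card U \<le> card {b\<in>U. R c b}"
proof (rule ccontr)
  assume "\<not> ?thesis"
  then have less: "card {b\<in>U. R c b} < \<delta> * card U" if "c \<in> A" for c
    using that by force
  have "card U * (\<delta> * card A) \<le> (\<Sum>b\<in>U. card {c\<in>A. R c b})"
    using sum_mono[OF hit, of U] by simp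
  also have "\<dots> = (\<Sum>c\<in>A. card {b\<in>U. R c b})"
    using assms(1,2) by (subst sum_multicount_gen[where R = "\<lambda>b c. R c b"]) auto
  also have "\<dots> < (\<Sum>c\<in>A. \<delta> * card U)"
    unfolding of_nat_sum using assms(2,3) less by (intro sum_strict_mono)
  finally show False by simp
qed

lemma greedy_partial_cover:
  fixes \<delta> :: real
  assumes "finite B" "finite A" "A \<noteq> {}" "\<delta> \<le> 1"
    and hit: "\<And>b. b \<in> B \<Longrightarrow> \<delta> * card A \<le> card {c\<in>A. R c b}"
  shows "\<exists>D\<subseteq>A. card D \<le> m \<and> card {b\<in>B. \<forall>c\<in>D. \<not> R c b} \<le> (1 - \<delta>) ^ m * card B"
proof (induction m)
  case 0
  then show ?case by (intro exI[of _ "{}"]) auto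
next
  case (Suc m)
  then obtain D where D: "D \<subseteq> A" "card D \<le> m"
    "card {b\<in>B. \<forall>c\<in>D. \<not> R c b} \<le> (1 - \<delta>) ^ m * card B" by blast
  let ?U = "{b\<in>B. \<forall>c\<in>D. \<not> R c b}"
  obtain c where c: "c \<in> A" "\<delta> * card ?U \<le> card {b\<in>?U. R c b}"
    using popular_element_exists[of ?U A \<delta> R] assms by auto
  have "{b\<in>B. \<forall>c\<in>insert c D. \<not> R c b} = ?U - {b\<in>?U. R c b}"
    by auto
  also have "real (card \<dots>) = real (card ?U) - card {b\<in>?U. R c b}"
    using assms(1) by (subst card_Diff_subset) (auto intro!: of_nat_diff card_mono)
  also have "\<dots> \<le> (1 - \<delta>) * card ?U"
    using c(2) by (simp add: algebra_simps)
  also have "\<dots> \<le> (1 - \<delta>) ^ Suc m * card B"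
    using mult_left_mono[OF D(3), of "1 - \<delta>"] assms(4) by (simp add: mult.assoc)
  finally have "card {b\<in>B. \<forall>c\<in>insert c D. \<not> R c b} \<le> (1 - \<delta>) ^ Suc m * card B" .
  moreover have "card (insert c D) \<le> Suc m"
    using D(2) card_insert_le_m1[of "Suc m" D c] by simp
  ultimately show ?case
    using D(1) c(1) by (intro exI[of _ "insert c D"]) auto
qed

lemma greedy_cover:
  fixes \<delta> :: real
  assumes "finite B" "finite A" "A \<noteq> {}" "0 < \<delta>" "\<delta> \<le> 1"
    and hit: "\<And>b. b \<in> B \<Longrightarrow> \<delta> * card A \<le> card {c\<in>A. R c b}"
  shows "\<exists>D\<subseteq>A. card D \<le> ln (card B) / \<delta> + 1 \<and> (\<forall>b\<in>B. \<exists>c\<in>D. R c b)"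
proof (cases "B = {}")
  case True
  then show ?thesis by (intro exI[of _ "{}"]) auto
next
  case False
  then have "1 \<le> card B"
    using assms(1) by (simp add: Suc_le_eq card_gt_0_iff)
  define m where "m = nat \<lfloor>ln (card B) / \<delta>\<rfloor> + 1"
  have "0 \<le> ln (card B) / \<delta>"
    using \<open>1 \<le> card B\<close> assms(4) by simp
  then have m: "ln (card B) / \<delta> < m" "m \<le> ln (card B) / \<delta> + 1"
    unfolding m_def by linarith+
  obtain D where D: "D \<subseteq> A" "card D \<le> m"
    "card {b\<in>B. \<forall>c\<in>D. \<not> R c b} \<le> (1 - \<delta>) ^ m * card B"
    using greedy_partial_cover[of B A \<delta> R m] assms by blast
  have "(1 - \<delta>) ^ m \<le> exp (- \<delta>) ^ m"
    using assms(5) exp_ge_add_one_self[of "- \<delta>"] by (intro power_mono) auto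
  also have "\<dots> = exp (- (m * \<delta>))"
    by (simp flip: exp_of_nat_mult)
  also have "\<dots> < exp (- ln (card B))"
    using m(1) assms(4) by (simp add: pos_divide_less_eq)
  also have "\<dots> = 1 / card B"
    using \<open>1 \<le> card B\<close> by (simp add: exp_minus divide_inverse)
  finally have "(1 - \<delta>) ^ m * card B < 1"
    using \<open>1 \<le> card B\<close> by (subst (asm) pos_less_divide_eq) auto
  then have "card {b\<in>B. \<forall>c\<in>D. \<not> R c b} = 0"
    using D(3) by linarith
  then have "\<forall>b\<in>B. \<exists>c\<in>D. R c b"
    using assms(1) by auto
  then show ?thesis
    using D(1,2) m(2) by (intro exI[of _ D]) auto
qed

lemma binomial_ratio_ge:
  fixes c :: real and a n r :: nat
  assumes "r \<le> a" "0 \<le> c" "c * n \<le> real a - r"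
  shows "c ^ r * (n choose r) \<le> a choose r"
proof -
  have "c ^ r * (n choose r) * fact r = c ^ r * real ((n choose r) * fact r)"
    by simp
  also have "\<dots> \<le> c ^ r * real (n ^ r)"
    using binomial_fact_pow[of n r] assms(2) by (intro mult_left_mono of_nat_mono) auto
  also have "\<dots> = (c * n) ^ r"
    by (simp add: power_mult_distrib)
  also have "\<dots> \<le> (real a - r) ^ r"
    using assms by (intro power_mono) auto
  also have "\<dots> = (\<Prod>i=0..<r. real a - r)"
    by simp
  also have "\<dots> \<le> (\<Prod>i=0..<r. real a - i)"
    using assms(1) by (intro prod_mono) auto
  also have "\<dots> = fact r * (real a gchoose r)"
    by (simp add: gbinomial_mult_fact)
  also have "\<dots> = (a choose r) * fact r"
    by (simp add: binomial_gbinomial)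
  finally show ?thesis by simp
qed

lemma ln_card_subsets_le:
  fixes n :: nat
  assumes "\<B> \<subseteq> Pow {..<n}"
  shows "ln (card \<B>) \<le> n"
proof (cases "card \<B> = 0")
  case False
  have "card \<B> \<le> 2 ^ n"
    using card_mono[OF _ assms] by (simp add: card_Pow)
  then have "real (card \<B>) \<le> 2 ^ n"
    by (simp flip: of_nat_le_iff)
  then have "ln (card \<B>) \<le> ln (2 ^ n)"
    using False by (intro ln_mono) auto
  also have "\<dots> = n * ln 2"
    by (simp add: ln_realpow)
  also have "\<dots> \<le> real n * 1"
    using ln_2_less_1 by (intro mult_left_mono) auto
  finally show ?thesis by simp
qed simp

lemma small_subset_cover_exists:
  fixes c :: real and a n r :: nat
  assumes "0 < n" "r \<le> a" "a \<le> n" "0 < c" "c * n \<le> real a - r"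
  shows "\<exists>\<K>. finite \<K> \<and> card \<K> \<le> 2 * real n / c ^ r \<and> (\<forall>K\<in>\<K>. finite K \<and> card K = r)
    \<and> (\<forall>S\<subseteq>{..<n}. a \<le> card S \<longrightarrow> (\<exists>K\<in>\<K>. K \<subseteq> S))"
proof -
  let ?A = "{K. K \<subseteq> {..<n} \<and> card K = r}" and ?B = "{S. S \<subseteq> {..<n} \<and> a \<le> card S}"
  have card_A: "card ?A = n choose r"
    by (simp add: n_subsets)
  have "c * n \<le> 1 * real n"
    using assms(3,5) by linarith
  then have "c \<le> 1"
    by (rule mult_right_le_imp_le) (use assms(1) in simp)
  have "\<exists>\<K>\<subseteq>?A. card \<K> \<le> ln (card ?B) / c ^ r + 1 \<and> (\<forall>S\<in>?B. \<exists>K\<in>\<K>. K \<subseteq> S)"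
  proof (rule greedy_cover)
    show "?A \<noteq> {}"
      using card_A assms(2,3) by (metis binomial_eq_0_iff card.empty le_trans not_le)
    show "c ^ r \<le> 1"
      using assms(4) \<open>c \<le> 1\<close> by (intro power_le_one) auto
    fix S assume S: "S \<in> ?B"
    then have "finite S"
      by (auto intro: finite_subset)
    have "{K\<in>?A. K \<subseteq> S} = {K. K \<subseteq> S \<and> card K = r}"
      using S by auto
    then have "card {K\<in>?A. K \<subseteq> S} = card S choose r"
      using \<open>finite S\<close> by (simp add: n_subsets)
    then show "c ^ r * card ?A \<le> card {K\<in>?A. K \<subseteq> S}"
      using S assms by (simp add: card_A binomial_ratio_ge)
  qed (use assms(4) in simp_all)
  then obtain \<K> where \<K>: "\<K> \<subseteq> ?A" "card \<K> \<le> ln (card ?B) / c ^ r + 1" "\<forall>S\<in>?B. \<exists>K\<in>\<K>. K \<subseteq> S"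
    by blast
  have "ln (card ?B) \<le> n"
    by (rule ln_card_subsets_le) auto
  then have "ln (card ?B) / c ^ r + 1 \<le> n / c ^ r + n / c ^ r"
    using assms(1,4) \<open>c \<le> 1\<close> power_le_one[of c r]
    by (intro add_mono divide_right_mono) (simp_all add: pos_le_divide_eq)
  then have "card \<K> \<le> 2 * real n / c ^ r"
    using \<K>(2) by simp
  moreover have "finite \<K>" "\<forall>K\<in>\<K>. finite K \<and> card K = r"
    using \<K>(1) by (auto intro: finite_subset)
  ultimately show ?thesis
    using \<K>(3) by (intro exI[of _ \<K>]) auto
qed

definition base_var :: "nat \<Rightarrow> nat" where
  "base_var i = prod_encode (0, i)"

definition aux_var :: "nat set \<Rightarrow> nat \<Rightarrow> nat" where
  "aux_var K t = prod_encode (Suc (set_encode K), t)"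

definition pos_clause :: "nat set \<Rightarrow> nat clause" where
  "pos_clause K = Pos ` base_var ` K"

definition neg_clause :: "nat \<Rightarrow> nat set \<Rightarrow> nat set \<Rightarrow> nat clause" where
  "neg_clause r K T = Neg ` base_var ` K \<union> Pos ` aux_var K ` T \<union> Neg ` aux_var K ` ({..<r} - T)"

definition cover_formula :: "nat \<Rightarrow> nat set set \<Rightarrow> nat set set \<Rightarrow> nat cnf" where
  "cover_formula r \<P> \<Q> = pos_clause ` \<P> \<union> (\<lambda>(K, T). neg_clause r K T) ` (\<Q> \<times> Pow {..<r})"

lemma var_simps [simp]:
  "base_var i = base_var j \<longleftrightarrow> i = j"
  "base_var i \<noteq> aux_var K t" "aux_var K t \<noteq> base_var i"
  "aux_var K s = aux_var K t \<longleftrightarrow> s = t"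
  by (auto simp: base_var_def aux_var_def)

lemma aux_var_eqD: "aux_var K s = aux_var L t \<Longrightarrow> finite K \<Longrightarrow> finite L \<Longrightarrow> K = L \<and> s = t"
  by (auto simp: aux_var_def set_encode_eq)

lemma is_clause_pos_clause: "finite K \<Longrightarrow> is_clause (pos_clause K)"
  by (auto simp: is_clause_def pos_clause_def)

lemma card_pos_clause: "card (pos_clause K) = card K"
  by (simp add: pos_clause_def card_image inj_on_def image_image)

lemma is_clause_neg_clause: "finite K \<Longrightarrow> T \<subseteq> {..<r} \<Longrightarrow> is_clause (neg_clause r K T)"
  by (auto simp: is_clause_def neg_clause_def intro: finite_subset)

lemma card_neg_clause:
  assumes "finite K" "T \<subseteq> {..<r}"
  shows "card (neg_clause r K T) = card K + r"
proof -
  have "finite T"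
    using assms(2) finite_subset by blast
  have "card (neg_clause r K T) = card (Neg ` base_var ` K) + card (Pos ` aux_var K ` T)
      + card (Neg ` aux_var K ` ({..<r} - T))"
    unfolding neg_clause_def using assms(1) \<open>finite T\<close>
    by (subst card_Un_disjoint; (subst card_Un_disjoint)?) auto
  also have "\<dots> = card K + card T + card ({..<r} - T)"
    by (simp add: card_image inj_on_def image_image)
  also have "\<dots> = card K + r"
    using assms(2) \<open>finite T\<close> card_mono[OF _ assms(2)] by (simp add: card_Diff_subset)
  finally show ?thesis .
qed

lemma is_k_cnf_cover_formula:
  assumes "finite \<P>" "\<And>K. K \<in> \<P> \<Longrightarrow> finite K \<and> card K = k"
    and "finite \<Q>" "\<And>K. K \<in> \<Q> \<Longrightarrow> finite K \<and> card K + r = k"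
  shows "is_k_cnf k (cover_formula r \<P> \<Q>)"
  using assms unfolding is_k_cnf_def is_cnf_def cover_formula_def
  by (auto simp: is_clause_pos_clause card_pos_clause is_clause_neg_clause card_neg_clause)

lemma cover_formula_unsat:
  assumes cover: "\<And>S. (\<exists>K\<in>\<P>. K \<inter> S = {}) \<or> (\<exists>K\<in>\<Q>. K \<subseteq> S)"
  shows "\<not> satisfiable (cover_formula r \<P> \<Q>)"
proof
  assume "satisfiable (cover_formula r \<P> \<Q>)"
  then obtain \<alpha> where \<alpha>: "\<And>C. C \<in> cover_formula r \<P> \<Q> \<Longrightarrow> \<not> falsifies \<alpha> C"
    by (auto simp: satisfiable_def satisfies_iff)
  define S where "S = {i. \<alpha> (base_var i)}"
  from cover[of S] show False
  proof
    assume "\<exists>K\<in>\<P>. K \<inter> S = {}"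
    then obtain K where "K \<in> \<P>" "K \<inter> S = {}" by blast
    then have "falsifies \<alpha> (pos_clause K)"
      by (auto simp: falsifies_def pos_clause_def S_def)
    then show False
      using \<alpha>[of "pos_clause K"] \<open>K \<in> \<P>\<close> by (auto simp: cover_formula_def)
  next
    assume "\<exists>K\<in>\<Q>. K \<subseteq> S"
    then obtain K where "K \<in> \<Q>" "K \<subseteq> S" by blast
    define T where "T = {t. t < r \<and> \<not> \<alpha> (aux_var K t)}"
    have "falsifies \<alpha> (neg_clause r K T)"
      using \<open>K \<subseteq> S\<close> by (auto simp: falsifies_def neg_clause_def S_def T_def)
    then show False
      using \<alpha>[of "neg_clause r K T"] \<open>K \<in> \<Q>\<close> by (auto simp: cover_formula_def T_def)
  qed
qed

lemma not_conflict_pos_clauses: "\<not> conflict (pos_clause K) (pos_clause L)"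
  by (auto simp: conflict_def pos_clause_def)

lemma conflict_neg_clausesD:
  "conflict (neg_clause r K S) (neg_clause r L T) \<Longrightarrow> finite K \<Longrightarrow> finite L \<Longrightarrow> K = L"
  by (auto simp: conflict_def neg_clause_def dest: aux_var_eqD)

lemma conflict_edges_cover_formula:
  assumes "\<And>K. K \<in> \<Q> \<Longrightarrow> finite K"
  shows "conflict_edges (cover_formula r \<P> \<Q>)
    \<subseteq> (\<lambda>(K, L, T). {pos_clause K, neg_clause r L T}) ` (\<P> \<times> \<Q> \<times> Pow {..<r})
      \<union> (\<lambda>(K, S, T). {neg_clause r K S, neg_clause r K T}) ` (\<Q> \<times> Pow {..<r} \<times> Pow {..<r})"
    (is "_ \<subseteq> ?mixed ` _ \<union> ?neg ` _")
proof
  fix e assume "e \<in> conflict_edges (cover_formula r \<P> \<Q>)"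
  then obtain C D where e: "e = {C, D}" "C \<in> cover_formula r \<P> \<Q>" "D \<in> cover_formula r \<P> \<Q>"
    "conflict C D"
    by (auto simp: conflict_edges_def)
  then consider (pos) K L where "C = pos_clause K" "D = pos_clause L"
    | (mixed) K L T where "K \<in> \<P>" "L \<in> \<Q>" "T \<subseteq> {..<r}" "e = ?mixed (K, L, T)"
    | (neg) K L S T where "K \<in> \<Q>" "L \<in> \<Q>" "S \<subseteq> {..<r}" "T \<subseteq> {..<r}"
        "C = neg_clause r K S" "D = neg_clause r L T"
    by (auto simp: cover_formula_def insert_commute)
  then show "e \<in> ?mixed ` (\<P> \<times> \<Q> \<times> Pow {..<r}) \<union> ?neg ` (\<Q> \<times> Pow {..<r} \<times> Pow {..<r})"
  proof cases
    case pos
    then show ?thesis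
      using e(4) not_conflict_pos_clauses by blast
  next
    case (mixed K L T)
    then show ?thesis by blast
  next
    case (neg K L S T)
    then have "K = L"
      using e(4) assms conflict_neg_clausesD by blast
    then have "e = ?neg (K, S, T)"
      using neg e(1) by simp
    then show ?thesis
      using neg by blast
  qed
qed

lemma num_conflicts_cover_formula_le:
  assumes "finite \<P>" "finite \<Q>" "\<And>K. K \<in> \<Q> \<Longrightarrow> finite K"
  shows "num_conflicts (cover_formula r \<P> \<Q>) \<le> card \<P> * (card \<Q> * 2 ^ r) + card \<Q> * 4 ^ r"
proof -
  let ?T = "Pow {..<r}"
  let ?mixed = "(\<lambda>(K, L, T). {pos_clause K, neg_clause r L T}) ` (\<P> \<times> \<Q> \<times> ?T)"
  let ?neg = "(\<lambda>(K, S, T). {neg_clause r K S, neg_clause r K T}) ` (\<Q> \<times> ?T \<times> ?T)"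
  have "num_conflicts (cover_formula r \<P> \<Q>) \<le> card (?mixed \<union> ?neg)"
    unfolding num_conflicts_def using assms
    by (intro card_mono conflict_edges_cover_formula) auto
  also have "\<dots> \<le> card ?mixed + card ?neg"
    by (rule card_Un_le)
  also have "\<dots> \<le> card (\<P> \<times> \<Q> \<times> ?T) + card (\<Q> \<times> ?T \<times> ?T)"
    using assms by (intro add_mono card_image_le) auto
  also have "\<dots> = card \<P> * (card \<Q> * 2 ^ r) + card \<Q> * 4 ^ r"
    by (simp add: card_cartesian_product card_Pow flip: power_mult_distrib)
  finally show ?thesis .
qed

lemma complementary_covers_exist:
  fixes c d :: real and a k l n :: nat
  assumes "0 < n" "l \<le> a" "a + k \<le> n"
    and "0 < c" "c * n \<le> real n - a - k" and "0 < d" "d * n \<le> real a - l"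
  shows "\<exists>\<P> \<Q> :: nat set set.
    finite \<P> \<and> card \<P> \<le> 2 * real n / c ^ k \<and> (\<forall>K\<in>\<P>. finite K \<and> card K = k) \<and>
    finite \<Q> \<and> card \<Q> \<le> 2 * real n / d ^ l \<and> (\<forall>K\<in>\<Q>. finite K \<and> card K = l) \<and>
    (\<forall>S. (\<exists>K\<in>\<P>. K \<inter> S = {}) \<or> (\<exists>K\<in>\<Q>. K \<subseteq> S))"
proof -
  have "k \<le> n - a" "a \<le> n" "c * n \<le> real (n - a) - k"
    using assms(3,5) by simp_all
  obtain \<P> where \<P>: "finite \<P>" "card \<P> \<le> 2 * real n / c ^ k" "\<And>K. K \<in> \<P> \<Longrightarrow> finite K \<and> card K = k"
    "\<And>S. S \<subseteq> {..<n} \<Longrightarrow> n - a \<le> card S \<Longrightarrow> \<exists>K\<in>\<P>. K \<subseteq> S"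
    using small_subset_cover_exists[OF \<open>0 < n\<close> \<open>k \<le> n - a\<close> diff_le_self \<open>0 < c\<close>
        \<open>c * n \<le> real (n - a) - k\<close>] by blast
  obtain \<Q> where \<Q>: "finite \<Q>" "card \<Q> \<le> 2 * real n / d ^ l" "\<And>K. K \<in> \<Q> \<Longrightarrow> finite K \<and> card K = l"
    "\<And>S. S \<subseteq> {..<n} \<Longrightarrow> a \<le> card S \<Longrightarrow> \<exists>K\<in>\<Q>. K \<subseteq> S"
    using small_subset_cover_exists[OF \<open>0 < n\<close> \<open>l \<le> a\<close> \<open>a \<le> n\<close> \<open>0 < d\<close>
        \<open>d * n \<le> real a - l\<close>] by blast
  have "(\<exists>K\<in>\<P>. K \<inter> S = {}) \<or> (\<exists>K\<in>\<Q>. K \<subseteq> S)" for S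
  proof (cases "a \<le> card (S \<inter> {..<n})")
    case True
    then show ?thesis
      using \<Q>(4)[of "S \<inter> {..<n}"] by blast
  next
    case False
    have "card ({..<n} - S) = n - card (S \<inter> {..<n})"
      by (simp add: card_Diff_subset_Int Int_commute)
    then have "n - a \<le> card ({..<n} - S)"
      using False by simp
    then obtain K where "K \<in> \<P>" "K \<subseteq> {..<n} - S"
      using \<P>(4)[of "{..<n} - S"] by blast
    then show ?thesis by blast
  qed
  then show ?thesis
    using \<P>(1-3) \<Q>(1-3) by (intro exI[of _ \<P>] exI[of _ \<Q>]) simp
qed

lemma unsat_k_cnf_exists:
  fixes c d :: real and a k l n :: nat
  assumes "0 < n" "l \<le> k" "l \<le> a" "a + k \<le> n"
    and c_bounds: "0 < c" "c * n \<le> real n - a - k" and d_bounds: "0 < d" "d * n \<le> real a - l"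
  shows "\<exists>F :: nat cnf. is_k_cnf k F \<and> \<not> satisfiable F
    \<and> num_conflicts F \<le> (2 * real n) ^ 2 * (2 ^ (k - l) / (c ^ k * d ^ l) + 4 ^ (k - l) / d ^ l)"
proof -
  from complementary_covers_exist[OF assms(1,3,4) c_bounds d_bounds] obtain \<P> \<Q> :: "nat set set"
    where \<P>: "finite \<P>" "card \<P> \<le> 2 * real n / c ^ k" "\<forall>K\<in>\<P>. finite K \<and> card K = k"
    and \<Q>: "finite \<Q>" "card \<Q> \<le> 2 * real n / d ^ l" "\<forall>K\<in>\<Q>. finite K \<and> card K = l"
    and cover: "\<forall>S. (\<exists>K\<in>\<P>. K \<inter> S = {}) \<or> (\<exists>K\<in>\<Q>. K \<subseteq> S)"
    by (elim exE conjE) (rule that)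
  let ?F = "cover_formula (k - l) \<P> \<Q>" and ?y = "2 * real n / d ^ l * 4 ^ (k - l)"
  have "1 \<le> 2 * real n" "0 \<le> ?y"
    using assms(1) d_bounds(1) by simp_all
  from mult_right_mono[OF this] have y_le: "?y \<le> 2 * real n * ?y"
    by (simp only: mult_1_left)
  have "real (num_conflicts ?F)
      \<le> real (card \<P>) * (real (card \<Q>) * 2 ^ (k - l)) + real (card \<Q>) * 4 ^ (k - l)"
    using of_nat_mono[OF num_conflicts_cover_formula_le[OF \<P>(1) \<Q>(1)]] \<Q>(3) by simp
  also have "\<dots> \<le> 2 * real n / c ^ k * (2 * real n / d ^ l * 2 ^ (k - l)) + ?y"
    using \<P>(2) \<Q>(2) c_bounds(1) d_bounds(1) by (intro add_mono mult_mono) auto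
  also have "\<dots> \<le> 2 * real n / c ^ k * (2 * real n / d ^ l * 2 ^ (k - l)) + 2 * real n * ?y"
    by (intro add_left_mono y_le)
  also have "\<dots> = (2 * real n) ^ 2 * (2 ^ (k - l) / (c ^ k * d ^ l) + 4 ^ (k - l) / d ^ l)"
    by (simp add: power2_eq_square algebra_simps)
  finally have "num_conflicts ?F
      \<le> (2 * real n) ^ 2 * (2 ^ (k - l) / (c ^ k * d ^ l) + 4 ^ (k - l) / d ^ l)" .
  moreover have "\<not> satisfiable ?F"
    using cover by (intro cover_formula_unsat) simp
  moreover have "is_k_cnf k ?F"
    using \<P>(1,3) \<Q>(1,3) assms(2) by (intro is_k_cnf_cover_formula) auto
  ultimately show ?thesis by blast
qed

text \<open>For negative parts of size \<open>\<lambda> k\<close> and threshold density \<open>p\<close>, the exponential rates of the two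
  kinds of conflicts are \<open>2 / (1 - p) * (2 p) powr (- \<lambda>)\<close> and \<open>4 * (4 p) powr (- \<lambda>)\<close>. They
  balance at \<open>\<lambda> = 1/3\<close> and \<open>p = 1 - 2 powr (- 2/3) = 0.37003\<dots>\<close>, near the optimum.\<close>

lemma conflict_rates_le:
  fixes c d :: real
  defines "c \<equiv> 62995 / 100000" and "d \<equiv> 37003 / 100000"
  shows "2 ^ (k - k div 3) / (c ^ k * d ^ (k div 3)) \<le> 16 * 43.242 ^ (k div 3)"
    and "4 ^ (k - k div 3) / d ^ (k div 3) \<le> 16 * 43.242 ^ (k div 3)"
proof -
  define l r where "l = k div 3" and "r = k mod 3"
  have "k = 3 * l + r" "r \<le> 2"
    by (auto simp: l_def r_def)
  then have k: "k = 3 * l + r" "k - l = 2 * l + r"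
    by auto
  have "(4::real) ^ r \<le> 4 ^ 2"
    using \<open>r \<le> 2\<close> by (rule power_increasing) simp
  then have pow_r: "(4::real) ^ r \<le> 16" by simp
  have "2 ^ (k - l) / (c ^ k * d ^ l) = (2 / c) ^ r * (4 / (c ^ 3 * d)) ^ l"
    unfolding k(1) k(2)[unfolded k(1)]
    by (simp add: power_add power_mult power_divide power_mult_distrib) (simp add: mult_ac)
  also have "\<dots> \<le> 4 ^ r * 43.242 ^ l"
    by (intro mult_mono power_mono) (auto simp: c_def d_def power_divide)
  also have "\<dots> \<le> 16 * 43.242 ^ l"
    using pow_r by (intro mult_right_mono) auto
  finally show "2 ^ (k - k div 3) / (c ^ k * d ^ (k div 3)) \<le> 16 * 43.242 ^ (k div 3)"
    by (simp only: l_def)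
  have "4 ^ (k - l) / d ^ l = 4 ^ r * (16 / d) ^ l"
    unfolding k(2) by (simp add: power_add power_mult power_divide)
  also have "\<dots> \<le> 16 * 43.242 ^ l"
    using pow_r by (intro mult_mono power_mono) (auto simp: d_def)
  finally show "4 ^ (k - k div 3) / d ^ (k div 3) \<le> 16 * 43.242 ^ (k div 3)"
    by (simp only: l_def)
qed

lemma sparse_unsat_k_cnf_exists:
  assumes "1 \<le> k"
  shows "\<exists>F :: nat cnf. is_k_cnf k F \<and> \<not> satisfiable F
    \<and> num_conflicts F \<le> (2 * 10 ^ 5 * real k) ^ 2 * (32 * 43.242 ^ (k div 3))"
proof -
  let ?l = "k div 3" and ?c = "62995 / 100000 :: real" and ?d = "37003 / 100000 :: real"
  let ?rates = "2 ^ (k - ?l) / (?c ^ k * ?d ^ ?l) + 4 ^ (k - ?l) / ?d ^ ?l"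
  have "\<exists>F :: nat cnf. is_k_cnf k F \<and> \<not> satisfiable F
      \<and> num_conflicts F \<le> (2 * real (10 ^ 5 * k)) ^ 2 * ?rates"
    by (rule unsat_k_cnf_exists[where a = "37004 * k"]) (use assms in auto)
  then obtain F :: "nat cnf" where F: "is_k_cnf k F" "\<not> satisfiable F"
    "num_conflicts F \<le> (2 * real (10 ^ 5 * k)) ^ 2 * ?rates"
    by blast
  note F(3)
  also have "(2 * real (10 ^ 5 * k)) ^ 2 * ?rates
      \<le> (2 * 10 ^ 5 * real k) ^ 2 * (32 * 43.242 ^ ?l)"
    using add_mono[OF conflict_rates_le[of k]] by (intro mult_mono) auto
  finally show ?thesis
    using F(1,2) by blast
qed

theorem num_conflicts_le:
  "\<exists>C::real. 0 < C \<and> (\<forall>k\<ge>1. \<exists>F :: nat cnf. is_k_cnf k F \<and> \<not> satisfiable F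
     \<and> num_conflicts F \<le> C * 3.51 ^ k)"
proof -
  define \<mu> :: real where "\<mu> = root 3 43.242"
  have "\<mu> ^ 3 = 43.242" "1 \<le> \<mu>"
    by (simp_all add: \<mu>_def)
  moreover have "\<mu> < 3.51"
    by (rule power_less_imp_less_base[of _ 3]) (simp_all add: \<open>\<mu> ^ 3 = 43.242\<close> power_divide)
  ultimately obtain B where B: "0 < B" "\<And>k. real k ^ 2 * \<mu> ^ k \<le> B * 3.51 ^ k"
    using polynomial_times_power_le[of \<mu> "3.51" 2] by auto
  have rate: "43.242 ^ (k div 3) \<le> \<mu> ^ k" for k
    using power_increasing[of "3 * (k div 3)" k \<mu>] \<open>\<mu> ^ 3 = 43.242\<close> \<open>1 \<le> \<mu>\<close>
    by (simp add: power_mult)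
  define C where "C = 32 * (2 * 10 ^ 5) ^ 2 * B"
  have "\<exists>F :: nat cnf. is_k_cnf k F \<and> \<not> satisfiable F \<and> num_conflicts F \<le> C * 3.51 ^ k"
    if "1 \<le> k" for k
  proof -
    obtain F :: "nat cnf" where F: "is_k_cnf k F" "\<not> satisfiable F"
      "num_conflicts F \<le> (2 * 10 ^ 5 * real k) ^ 2 * (32 * 43.242 ^ (k div 3))"
      using sparse_unsat_k_cnf_exists[OF \<open>1 \<le> k\<close>] by blast
    note F(3)
    also have "(2 * 10 ^ 5 * real k) ^ 2 * (32 * 43.242 ^ (k div 3))
        \<le> (2 * 10 ^ 5 * real k) ^ 2 * (32 * \<mu> ^ k)"
      by (intro mult_left_mono rate) auto
    also have "\<dots> = 32 * (2 * 10 ^ 5) ^ 2 * (real k ^ 2 * \<mu> ^ k)"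
      by (simp add: power_mult_distrib)
    also have "\<dots> \<le> C * 3.51 ^ k"
      using B(2)[of k] by (simp add: C_def)
    finally show ?thesis
      using F(1,2) by blast
  qed
  then show ?thesis
    using B(1) by (intro exI[of _ C]) (auto simp: C_def)
qed

theorem theorem1:
  shows "(\<exists>c::real. c > 0 \<and>
            (\<forall>k::nat. k \<ge> 1 \<longrightarrow>
              (\<forall>F :: nat cnf. is_k_cnf k F \<and> \<not> satisfiable F \<longrightarrow>
                 real (num_conflicts F) \<ge> c * 2.69 ^ k)))
       \<and> (\<exists>C::real. C > 0 \<and>
            (\<forall>k::nat. k \<ge> 1 \<longrightarrow>
              (\<exists>F :: nat cnf. is_k_cnf k F \<and> \<not> satisfiable F \<and>
                 real (num_conflicts F) \<le> C * 3.51 ^ k)))"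
  using num_conflicts_ge[where 'v = nat] num_conflicts_le by blast

end
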